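(* Let $\mathbb{F}$ be a field of characteristic $0$, let $\mathcal{A}$ be a Lie conformal algebra over $\mathbb{F}$ that is free as an $\mathbb{F}[\partial]$-module and contains a Virasoro element $L$, and let $M$ be an $\mathcal{A}$-module that is free as an $\mathbb{F}[\partial]$-module and conformal with respect to $L$. Let $q\ge 0$ and let $f\in\widetilde{C}^q(\mathcal{A},M)$ be an eigenvector of the energy operator $\widetilde{E}$. If $f$ is a cocycle (i.e. $\mathbf{d}f=0$) but not a coboundary, then its conformal weight $\Delta(f)$ (its $\widetilde{E}$-eigenvalue) equals zero.
   Context: Lie conformal algebra (LCA): an $\mathbb{F}[\partial]$-module $\mathcal{A}$ with an $\mathbb{F}$-bilinear $\lambda$-bracket $\mathcal{A}\otimes\mathcal{A}\to\mathcal{A}[\lambda]$, $a\otimes b\mapsto[a_\lambda b]$, such that $[\partial a_\lambda b]=-\lambda[a_\lambda b]$, $[a_\lambda\partial b]=(\partial+\lambda)[a_\lambda b]$, $[a_\lambda b]=-[b_{-\lambda-\partial}a]$, and $[a_\lambda[b_\mu c]]=[[a_\lambda b]_{\lambda+\mu}c]+[b_\mu[a_\lambda c]]$. An $\mathcal{A}$-module is an $\mathbb{F}[\partial]$-module $M$ with an $\mathbb{F}$-bilinear $\lambda$-action $\mathcal{A}\otimes M\to M[\lambda]$, $a\otimes m\mapsto a_\lambda m$, such that $(\partial a)_\lambda m=-\lambda a_\lambda m$, $a_\lambda(\partial m)=(\partial+\lambda)a_\lambda m$, $a_\lambda(b_\mu m)-b_\mu(a_\lambda m)=[a_\lambda b]_{\lambda+\mu}m$.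 Write $\partial^M$ for the action of $\partial$ on $M$. Basic complex: for $q\ge 1$, $\widetilde{C}^q(\mathcal{A},M)$ is the space of $\mathbb{F}$-linear maps $f:\mathcal{A}^{\otimes q}\to M[\lambda_1,\dots,\lambda_q]$, $a_1\otimes\cdots\otimes a_q\mapsto f_{\lambda_1,\dots,\lambda_q}(a_1,\dots,a_q)$, with $f_{\lambda_1,\dots,\lambda_q}(a_1,\dots,\partial a_i,\dots,a_q)=-\lambda_i f_{\lambda_1,\dots,\lambda_q}(a_1,\dots,a_q)$ for all $i$ (conformal antilinearity), and skew-symmetric under simultaneous permutations of the $a_i$ and the $\lambda_i$. Also $\widetilde{C}^0(\mathcal{A},M)=M$. The differential $\mathbf{d}:\widetilde{C}^q\to\widetilde{C}^{q+1}$ is $$(\mathbf{d}f)_{\lambda_1,\dots,\lambda_{q+1}}(a_1,\dots,a_{q+1})=\sum_{k}(-1)^{k+1}a_{k\,\lambda_k}f_{\lambda_1,\dots,\hat\lambda_k,\dots,\lambda_{q+1}}(a_1,\dots,\hat a_k,\dots,a_{q+1})+\sum_{k<l}(-1)^{k+l}f_{\lambda_k+\lambda_l,\lambda_1,\dots,\hat\lambda_k,\dots,\hat\lambda_l,\dots,\lambda_{q+1}}([a_{k\,\lambda_k}a_l],a_1,\dots,\hat a_k,\dots,\hat a_l,\dots,a_{q+1}),$$ with $(\mathbf{d}m)_\lambda(a)=a_\lambda m$ for $m\in M$; hats denote omission, and polynomial coefficients in the $\lambda$'s are extended linearly. One has $\mathbf{d}^2=0$. A $q$-cochain $f$ is a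 cocycle if $\mathbf{d}f=0$, and a coboundary if $f=\mathbf{d}g$ for some $g\in\widetilde{C}^{q-1}(\mathcal{A},M)$, with $\widetilde{C}^{-1}=0$. A Virasoro element is $L\in\mathcal{A}$ with $[L_\lambda L]=(\partial+2\lambda)L$, $L_{(0)}:=[L_\lambda\,\cdot\,]|_{\lambda=0}=\partial$ on $\mathcal{A}$, and $L_{(1)}:=\frac{d}{d\lambda}[L_\lambda\,\cdot\,]|_{\lambda=0}$ diagonalizable on $\mathcal{A}$. $M$ is conformal with respect to $L$ if $L^M_{(0)}:=(L_\lambda\,\cdot\,)|_{\lambda=0}=\partial^M$ and $L^M_{(1)}:=\frac{d}{d\lambda}(L_\lambda\,\cdot\,)|_{\lambda=0}$ is diagonalizable on $M$. Standing convention: $\mathcal{A}$ and $M$ have $\mathbb{F}[\partial]$-bases consisting of eigenvectors of $L_{(1)}$ and $L^M_{(1)}$ respectively. For an eigenvector $a$ of $L_{(1)}$, $\Delta(a)$ denotes its eigenvalue. Energy operator: on $M[\lambda_1,\dots,\lambda_q]$ let $E=L^M_{(1)}+\sum_{i=1}^q\lambda_i\frac{d}{d\lambda_i}$. The operator $\widetilde{E}$ on $\widetilde{C}^q(\mathcal{A},M)$ is defined, for $a_1,\dots,a_q$ eigenvectors of $L_{(1)}$, by $$(\widetilde{E}f)_{\lambda_1,\dots,\lambda_q}(a_1,\dots,a_q)=E\big(f_{\lambda_1,\dots,\lambda_q}(a_1,\dots,a_q)\big)+\Big(q-\sum_{i=1}^q\Delta(a_i)\Big)f_{\lambda_1,\dots,\lambda_q}(a_1,\dots,a_q)$$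 (so $\widetilde{E}=L^M_{(1)}$ for $q=0$). If $f$ is an eigenvector of $\widetilde{E}$, its eigenvalue $\Delta(f)$ is called its conformal weight. *)

theory Defs
  imports
    "HOL-Computational_Algebra.Polynomial"
    "HOL-Library.Poly_Mapping"
    "HOL-Combinatorics.Permutations"
begin

section \<open>Polynomials with coefficients in a module\<close>

text \<open>
  An F[d]-module is given by a scalar multiplication s :: 'f poly => 'b => 'b satisfying the
  library predicate module; d acts as s [:0, 1:], and F acts through the constant polynomials.

  V[lambda_0, lambda_1, ...] is the type of finitely supported maps from exponent vectors to V.
  It is a module over R[lambda_0, lambda_1, ...] whenever V is a module over R; we use this
  with R = F[d], so that d and the lambda_i are both available as scalars.
  Variables are numbered from 0.
\<close>

type_synonym 'b mpol = "(nat \<Rightarrow>\<^sub>0 nat) \<Rightarrow>\<^sub>0 'b"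

definition fscale :: "('f::field poly \<Rightarrow> 'b::ab_group_add \<Rightarrow> 'b) \<Rightarrow> 'f \<Rightarrow> 'b \<Rightarrow> 'b" where
  "fscale s c v = s [:c:] v"

definition del :: "('f::field poly \<Rightarrow> 'b::ab_group_add \<Rightarrow> 'b) \<Rightarrow> 'b \<Rightarrow> 'b" where
  "del s v = s [:0, 1:] v"

definition cst :: "'b::zero \<Rightarrow> 'b mpol" where
  "cst v = Poly_Mapping.single 0 v"

definition lmono :: "(nat \<Rightarrow>\<^sub>0 nat) \<Rightarrow> 'f::field poly mpol" where
  "lmono e = Poly_Mapping.single e 1"

definition lam :: "nat \<Rightarrow> 'f::field poly mpol" where
  "lam i = lmono (Poly_Mapping.single i 1)"

definition dd :: "'f::field poly mpol" where
  "dd = cst [:0, 1:]"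

definition pscale ::
  "('f::field poly \<Rightarrow> 'b::ab_group_add \<Rightarrow> 'b) \<Rightarrow> 'f poly mpol \<Rightarrow> 'b mpol \<Rightarrow> 'b mpol" where
  "pscale s p v = (\<Sum>e\<in>Poly_Mapping.keys p. \<Sum>e'\<in>Poly_Mapping.keys v.
     Poly_Mapping.single (e + e') (s (Poly_Mapping.lookup p e) (Poly_Mapping.lookup v e')))"

text \<open>The value at lambda = t of a one-variable polynomial P(lambda); powers of t, which may
  involve d, act on the coefficients from the left.\<close>

definition ev ::
  "('f::field poly \<Rightarrow> 'b::ab_group_add \<Rightarrow> 'b) \<Rightarrow> 'f poly mpol \<Rightarrow> 'b poly \<Rightarrow> 'b mpol" where
  "ev s t P = (\<Sum>n\<le>degree P. pscale s (t ^ n) (cst (coeff P n)))"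

text \<open>Simultaneous substitution of ts ! i for lambda_i, i < length ts.\<close>

definition psubst ::
  "('f::field poly \<Rightarrow> 'b::ab_group_add \<Rightarrow> 'b) \<Rightarrow> 'f poly mpol list \<Rightarrow> 'b mpol \<Rightarrow> 'b mpol" where
  "psubst s ts v = (\<Sum>e\<in>Poly_Mapping.keys v.
     pscale s (\<Prod>i<length ts. (ts ! i) ^ Poly_Mapping.lookup e i) (cst (Poly_Mapping.lookup v e)))"

text \<open>The partial derivative of v with respect to lambda_i.\<close>

definition pd ::
  "('f::field poly \<Rightarrow> 'b::ab_group_add \<Rightarrow> 'b) \<Rightarrow> nat \<Rightarrow> 'b mpol \<Rightarrow> 'b mpol" where
  "pd s i v = (\<Sum>e\<in>Poly_Mapping.keys v.
     Poly_Mapping.single (e - Poly_Mapping.single i 1)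
       (fscale s (of_nat (Poly_Mapping.lookup e i)) (Poly_Mapping.lookup v e)))"

text \<open>For a lambda-product br, this is u_t v for u, v with polynomial coefficients, extended
  linearly in both arguments.\<close>

definition lprod ::
  "('f::field poly \<Rightarrow> 'b::ab_group_add \<Rightarrow> 'b) \<Rightarrow> ('a::zero \<Rightarrow> 'b \<Rightarrow> 'b poly) \<Rightarrow>
   'f poly mpol \<Rightarrow> 'a mpol \<Rightarrow> 'b mpol \<Rightarrow> 'b mpol" where
  "lprod s br t u v = (\<Sum>e\<in>Poly_Mapping.keys u. \<Sum>e'\<in>Poly_Mapping.keys v.
     pscale s (lmono (e + e')) (ev s t (br (Poly_Mapping.lookup u e) (Poly_Mapping.lookup v e'))))"

section \<open>Lie conformal algebras and their modules\<close>

definition lbilinear ::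
  "('f::field poly \<Rightarrow> 'a::ab_group_add \<Rightarrow> 'a) \<Rightarrow> ('f poly \<Rightarrow> 'b::ab_group_add \<Rightarrow> 'b) \<Rightarrow>
   ('a \<Rightarrow> 'b \<Rightarrow> 'b poly) \<Rightarrow> bool" where
  "lbilinear sA sM br \<longleftrightarrow>
     (\<forall>b. Vector_Spaces.linear (fscale sA) (\<lambda>c. map_poly (fscale sM c)) (\<lambda>a. br a b)) \<and>
     (\<forall>a. Vector_Spaces.linear (fscale sM) (\<lambda>c. map_poly (fscale sM c)) (\<lambda>b. br a b))"

locale lie_conformal_algebra = module sA
  for sA :: "'f::field_char_0 poly \<Rightarrow> 'a::ab_group_add \<Rightarrow> 'a" +
  fixes br :: "'a \<Rightarrow> 'a \<Rightarrow> 'a poly"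
  assumes br_bilinear: "lbilinear sA sA br"
    and br_del_left: "ev sA (lam 0) (br (del sA a) b) = pscale sA (- lam 0) (ev sA (lam 0) (br a b))"
    and br_del_right:
      "ev sA (lam 0) (br a (del sA b)) = pscale sA (dd + lam 0) (ev sA (lam 0) (br a b))"
    and br_skew: "ev sA (lam 0) (br a b) = - ev sA (- lam 0 - dd) (br b a)"
    and br_jacobi:
      "lprod sA br (lam 0) (cst a) (lprod sA br (lam 1) (cst b) (cst c)) =
       lprod sA br (lam 0 + lam 1) (lprod sA br (lam 0) (cst a) (cst b)) (cst c) +
       lprod sA br (lam 1) (cst b) (lprod sA br (lam 0) (cst a) (cst c))"

locale lca_module = lie_conformal_algebra sA br + M: module sM
  for sA :: "'f::field_char_0 poly \<Rightarrow> 'a::ab_group_add \<Rightarrow> 'a"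
    and br :: "'a \<Rightarrow> 'a \<Rightarrow> 'a poly"
    and sM :: "'f poly \<Rightarrow> 'm::ab_group_add \<Rightarrow> 'm" +
  fixes act :: "'a \<Rightarrow> 'm \<Rightarrow> 'm poly"
  assumes act_bilinear: "lbilinear sA sM act"
    and act_del_left:
      "ev sM (lam 0) (act (del sA a) m) = pscale sM (- lam 0) (ev sM (lam 0) (act a m))"
    and act_del_right:
      "ev sM (lam 0) (act a (del sM m)) = pscale sM (dd + lam 0) (ev sM (lam 0) (act a m))"
    and act_bracket:
      "lprod sM act (lam 0) (cst a) (lprod sM act (lam 1) (cst b) (cst m)) -
       lprod sM act (lam 1) (cst b) (lprod sM act (lam 0) (cst a) (cst m)) =
       lprod sM act (lam 0 + lam 1) (lprod sA br (lam 0) (cst a) (cst b)) (cst m)"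

section \<open>Virasoro elements and conformal modules\<close>

definition is_basis :: "('r::comm_ring_1 \<Rightarrow> 'b::ab_group_add \<Rightarrow> 'b) \<Rightarrow> 'b set \<Rightarrow> bool" where
  "is_basis s B \<longleftrightarrow> \<not> module.dependent s B \<and> module.span s B = UNIV"

definition eigenvector ::
  "('f::field poly \<Rightarrow> 'b::ab_group_add \<Rightarrow> 'b) \<Rightarrow> ('b \<Rightarrow> 'b) \<Rightarrow> 'f \<Rightarrow> 'b \<Rightarrow> bool" where
  "eigenvector s T c v \<longleftrightarrow> v \<noteq> 0 \<and> T v = fscale s c v"

definition diagonalizable ::
  "('f::field poly \<Rightarrow> 'b::ab_group_add \<Rightarrow> 'b) \<Rightarrow> ('b \<Rightarrow> 'b) \<Rightarrow> bool" where
  "diagonalizable s T \<longleftrightarrow> (\<exists>B. is_basis (fscale s) B \<and> (\<forall>b\<in>B. \<exists>c. eigenvector s T c b))"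

text \<open>The module is free over F[d], with a basis of eigenvectors of T.\<close>

definition free_on_eigenvectors ::
  "('f::field poly \<Rightarrow> 'b::ab_group_add \<Rightarrow> 'b) \<Rightarrow> ('b \<Rightarrow> 'b) \<Rightarrow> bool" where
  "free_on_eigenvectors s T \<longleftrightarrow> (\<exists>B. is_basis s B \<and> (\<forall>b\<in>B. \<exists>c. eigenvector s T c b))"

text \<open>For n = 0, 1 the n-th derivative at lambda = 0 is the coefficient of lambda^n.\<close>

definition L0 :: "('a \<Rightarrow> 'b \<Rightarrow> 'b::zero poly) \<Rightarrow> 'a \<Rightarrow> 'b \<Rightarrow> 'b" where
  "L0 br L v = coeff (br L v) 0"

definition L1 :: "('a \<Rightarrow> 'b \<Rightarrow> 'b::zero poly) \<Rightarrow> 'a \<Rightarrow> 'b \<Rightarrow> 'b" where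
  "L1 br L v = coeff (br L v) 1"

definition virasoro_element ::
  "('f::field poly \<Rightarrow> 'a::ab_group_add \<Rightarrow> 'a) \<Rightarrow> ('a \<Rightarrow> 'a \<Rightarrow> 'a poly) \<Rightarrow> 'a \<Rightarrow> bool" where
  "virasoro_element sA br L \<longleftrightarrow>
     ev sA (lam 0) (br L L) = pscale sA (dd + 2 * lam 0) (cst L) \<and>
     L0 br L = del sA \<and> diagonalizable sA (L1 br L)"

definition conformal_module ::
  "('f::field poly \<Rightarrow> 'm::ab_group_add \<Rightarrow> 'm) \<Rightarrow> ('a \<Rightarrow> 'm \<Rightarrow> 'm poly) \<Rightarrow> 'a \<Rightarrow> bool" where
  "conformal_module sM act L \<longleftrightarrow> L0 act L = del sM \<and> diagonalizable sM (L1 act L)"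

section \<open>The basic complex\<close>

text \<open>
  A q-cochain is a multilinear function of the list of its q arguments, extended by 0 to lists
  of other lengths so that equality of cochains is equality of functions. For q = 0 it is just
  its value at the empty list, which is a constant polynomial, i.e. an element of M.
\<close>

definition cochains ::
  "('f::field poly \<Rightarrow> 'a::ab_group_add \<Rightarrow> 'a) \<Rightarrow> ('f poly \<Rightarrow> 'm::ab_group_add \<Rightarrow> 'm) \<Rightarrow>
   nat \<Rightarrow> ('a list \<Rightarrow> 'm mpol) set" where
  "cochains sA sM q = {f.
     (\<forall>as. length as \<noteq> q \<longrightarrow> f as = 0) \<and>
     (\<forall>as. \<forall>e\<in>Poly_Mapping.keys (f as). Poly_Mapping.keys e \<subseteq> {..<q}) \<and>
     (\<forall>as i. length as = q \<and> i < q \<longrightarrow>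
        Vector_Spaces.linear (fscale sA) (\<lambda>c. pscale sM (cst [:c:])) (\<lambda>a. f (as[i := a]))) \<and>
     (\<forall>as i. length as = q \<and> i < q \<longrightarrow>
        f (as[i := del sA (as ! i)]) = pscale sM (- lam i) (f as)) \<and>
     (\<forall>as \<pi>. length as = q \<and> \<pi> permutes {..<q} \<longrightarrow>
        psubst sM (permute_list \<pi> (map lam [0..<q])) (f (permute_list \<pi> as)) =
          pscale sM (of_int (sign \<pi>)) (f as))}"

text \<open>The value f_ts(u, as), extended linearly to a first argument u with polynomial
  coefficients.\<close>

definition apply_first ::
  "('f::field poly \<Rightarrow> 'm::ab_group_add \<Rightarrow> 'm) \<Rightarrow> ('a::ab_group_add list \<Rightarrow> 'm mpol) \<Rightarrow>
   'f poly mpol list \<Rightarrow> 'a mpol \<Rightarrow> 'a list \<Rightarrow> 'm mpol" where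
  "apply_first sM f ts u as = (\<Sum>e\<in>Poly_Mapping.keys u.
     pscale sM (lmono e) (psubst sM ts (f (Poly_Mapping.lookup u e # as))))"

text \<open>
  Indices start at 0, so the signs (-1)^(k+1) and (-1)^(k+l) of the formula with indices
  starting at 1 become (-1)^k and (-1)^(k+l). On lists whose length is not one more than the
  degree of f, all terms vanish.
\<close>

definition differential ::
  "('f::field poly \<Rightarrow> 'a::ab_group_add \<Rightarrow> 'a) \<Rightarrow> ('a \<Rightarrow> 'a \<Rightarrow> 'a poly) \<Rightarrow>
   ('f poly \<Rightarrow> 'm::ab_group_add \<Rightarrow> 'm) \<Rightarrow> ('a \<Rightarrow> 'm \<Rightarrow> 'm poly) \<Rightarrow>
   ('a list \<Rightarrow> 'm mpol) \<Rightarrow> 'a list \<Rightarrow> 'm mpol" where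
  "differential sA br sM act f as =
     (let n = length as; ls = map lam [0..<n] in
      (\<Sum>k<n. pscale sM ((-1) ^ k)
         (lprod sM act (lam k) (cst (as ! k)) (psubst sM (nths ls (- {k})) (f (nths as (- {k})))))) +
      (\<Sum>l<n. \<Sum>k<l. pscale sM ((-1) ^ (k + l))
         (apply_first sM f ((lam k + lam l) # nths ls (- {k, l}))
            (ev sA (lam k) (br (as ! k) (as ! l))) (nths as (- {k, l})))))"

definition cocycle ::
  "('f::field poly \<Rightarrow> 'a::ab_group_add \<Rightarrow> 'a) \<Rightarrow> ('a \<Rightarrow> 'a \<Rightarrow> 'a poly) \<Rightarrow>
   ('f poly \<Rightarrow> 'm::ab_group_add \<Rightarrow> 'm) \<Rightarrow> ('a \<Rightarrow> 'm \<Rightarrow> 'm poly) \<Rightarrow>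
   ('a list \<Rightarrow> 'm mpol) \<Rightarrow> bool" where
  "cocycle sA br sM act f \<longleftrightarrow> differential sA br sM act f = (\<lambda>_. 0)"

definition coboundary ::
  "('f::field poly \<Rightarrow> 'a::ab_group_add \<Rightarrow> 'a) \<Rightarrow> ('a \<Rightarrow> 'a \<Rightarrow> 'a poly) \<Rightarrow>
   ('f poly \<Rightarrow> 'm::ab_group_add \<Rightarrow> 'm) \<Rightarrow> ('a \<Rightarrow> 'm \<Rightarrow> 'm poly) \<Rightarrow>
   nat \<Rightarrow> ('a list \<Rightarrow> 'm mpol) \<Rightarrow> bool" where
  "coboundary sA br sM act q f \<longleftrightarrow>
     (case q of 0 \<Rightarrow> f = (\<lambda>_. 0)
      | Suc p \<Rightarrow> (\<exists>g\<in>cochains sA sM p. f = differential sA br sM act g))"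

section \<open>The energy operator\<close>

definition energyM ::
  "('f::field poly \<Rightarrow> 'm::ab_group_add \<Rightarrow> 'm) \<Rightarrow> ('a \<Rightarrow> 'm \<Rightarrow> 'm poly) \<Rightarrow> 'a \<Rightarrow>
   nat \<Rightarrow> 'm mpol \<Rightarrow> 'm mpol" where
  "energyM sM act L q v =
     Poly_Mapping.map (L1 act L) v + (\<Sum>i<q. pscale sM (lam i) (pd sM i v))"

text \<open>The energy operator maps f to the unique cochain with the prescribed values on
  eigenvectors; ds is the list of eigenvalues of the entries of as.\<close>

definition energy ::
  "('f::field poly \<Rightarrow> 'a::ab_group_add \<Rightarrow> 'a) \<Rightarrow> ('a \<Rightarrow> 'a \<Rightarrow> 'a poly) \<Rightarrow>
   ('f poly \<Rightarrow> 'm::ab_group_add \<Rightarrow> 'm) \<Rightarrow> ('a \<Rightarrow> 'm \<Rightarrow> 'm poly) \<Rightarrow> 'a \<Rightarrow>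
   nat \<Rightarrow> ('a list \<Rightarrow> 'm mpol) \<Rightarrow> 'a list \<Rightarrow> 'm mpol" where
  "energy sA br sM act L q f = (THE g. g \<in> cochains sA sM q \<and>
     (\<forall>as ds. length as = q \<and> list_all2 (eigenvector sA (L1 br L)) ds as \<longrightarrow>
        g as = energyM sM act L q (f as) +
               pscale sM (cst [:of_nat q - sum_list ds:]) (f as)))"

definition conformal_weight ::
  "('f::field poly \<Rightarrow> 'a::ab_group_add \<Rightarrow> 'a) \<Rightarrow> ('a \<Rightarrow> 'a \<Rightarrow> 'a poly) \<Rightarrow>
   ('f poly \<Rightarrow> 'm::ab_group_add \<Rightarrow> 'm) \<Rightarrow> ('a \<Rightarrow> 'm \<Rightarrow> 'm poly) \<Rightarrow> 'a \<Rightarrow>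
   nat \<Rightarrow> ('a list \<Rightarrow> 'm mpol) \<Rightarrow> 'f \<Rightarrow> bool" where
  "conformal_weight sA br sM act L q f \<Delta> \<longleftrightarrow>
     f \<noteq> (\<lambda>_. 0) \<and> energy sA br sM act L q f = (\<lambda>as. pscale sM (cst [:\<Delta>:]) (f as))"

end

theory Submission
  imports Defs
begin

text \<open>
  The energy operator is null-homotopic on the basic complex. For a cochain \<open>f\<close> of degree \<open>q\<close> let
  the contraction of \<open>f\<close> be the derivative, at 0, with respect to the variable of L, of \<open>f\<close> with L
  inserted as an additional argument. As in Cartan's formula for the Lie derivative, inserting L
  commutes with the differential up to the operator by which L acts on cochains, apart from signs,
  and taking the derivative at 0 turns this operator into the energy operator
  (\<open>homotopy_formula\<close>). Indeed, the action of L on the values of \<open>f\<close> contributes its linear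
  coefficient \<open>L1\<close> on M. The bracket of L with the \<open>k\<close>-th argument \<open>a\<close> contributes \<open>- f\<close> with \<open>L1\<close>
  applied to \<open>a\<close> and, since \<open>L0 a = d a\<close> enters \<open>f\<close> as multiplication by minus the variable, also
  the Euler operator of the \<open>k\<close>-th variable and one copy of \<open>f\<close> (\<open>lcoeff_bracket_term\<close>). On
  eigenvectors the sum of all these terms is the energy operator.

  If \<open>f\<close> is a cocycle of weight \<open>\<Delta>\<close>, then \<open>\<Delta> f\<close> is therefore, up to sign, the differential of the
  contraction of \<open>f\<close>, which is a cochain (\<open>contraction_cochain\<close>). For \<open>\<Delta> \<noteq> 0\<close> this makes \<open>f\<close> a
  coboundary. In degree 0 the contraction of \<open>f\<close> has differential 0, and the same formula shows
  that \<open>\<Delta> f = 0\<close>.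

  The energy operator is specified by its values on eigenvectors of \<open>L1\<close>. To use it one has to know
  that a cochain with these values exists and is unique. Existence comes from a formula that does
  not mention eigenvalues (\<open>explicit_energy_cochain\<close>), uniqueness from multilinearity and the
  basis of eigenvectors (\<open>cochains_eqI\<close>).
\<close>

section \<open>Additive maps on polynomials with module coefficients\<close>

lemma additive_compose:
  assumes "additive F" "additive G"
  shows "additive (\<lambda>v. F (G v))"
  using assms by (simp add: additive_def)

lemma additive_sum_fun:
  assumes "\<And>i. i \<in> I \<Longrightarrow> additive (F i)"
  shows "additive (\<lambda>v. \<Sum>i\<in>I. F i v)"
  using assms by (simp add: additive_def sum.distrib)

lemma additive_single: "additive (\<lambda>b. Poly_Mapping.single e b)"
  by (simp add: additive_def single_add)

lemma sum_keys_superset: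
  assumes "finite K" "Poly_Mapping.keys v \<subseteq> K" "\<And>e. h e 0 = 0"
  shows "(\<Sum>e\<in>Poly_Mapping.keys v. h e (Poly_Mapping.lookup v e)) =
    (\<Sum>e\<in>K. h e (Poly_Mapping.lookup v e))"
  using assms by (intro sum.mono_neutral_left) (auto simp: in_keys_iff)

lemma additive_sum_keys:
  assumes "\<And>e. additive (h e)"
  shows "additive (\<lambda>v. \<Sum>e\<in>Poly_Mapping.keys v. h e (Poly_Mapping.lookup v e))"
proof
  fix u v :: "'a \<Rightarrow>\<^sub>0 'b"
  let ?K = "Poly_Mapping.keys u \<union> Poly_Mapping.keys v"
  have z: "h e 0 = 0" for e using additive.zero[OF assms] .
  have "(\<Sum>e\<in>Poly_Mapping.keys w. h e (Poly_Mapping.lookup w e)) =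
      (\<Sum>e\<in>?K. h e (Poly_Mapping.lookup w e))" if "Poly_Mapping.keys w \<subseteq> ?K" for w
    using that by (intro sum_keys_superset) (auto simp: z)
  moreover have "Poly_Mapping.keys (u + v) \<subseteq> ?K" by (rule keys_add)
  ultimately show "(\<Sum>e\<in>Poly_Mapping.keys (u + v). h e (Poly_Mapping.lookup (u + v) e)) =
    (\<Sum>e\<in>Poly_Mapping.keys u. h e (Poly_Mapping.lookup u e)) +
    (\<Sum>e\<in>Poly_Mapping.keys v. h e (Poly_Mapping.lookup v e))"
    by (simp only: subset_refl Un_upper1 Un_upper2)
      (simp add: lookup_add additive.add[OF assms] sum.distrib)
qed

lemma mpol_sum_singles:
  "v = (\<Sum>e\<in>Poly_Mapping.keys v. Poly_Mapping.single e (Poly_Mapping.lookup v e))"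
  by (rule poly_mapping_eqI)
    (auto simp: lookup_sum lookup_single when_def in_keys_iff)

text \<open>
  Two additive maps that agree on the terms of a polynomial agree on it. All operations on
  polynomials below are additive in each argument, so identities between them are checked on
  single terms, where the operations reduce to arithmetic with exponent vectors.
\<close>

lemma additive_eqI:
  assumes "additive F" "additive G"
    and "\<And>e. e \<in> Poly_Mapping.keys v \<Longrightarrow>
      F (Poly_Mapping.single e (Poly_Mapping.lookup v e)) =
      G (Poly_Mapping.single e (Poly_Mapping.lookup v e))"
  shows "F v = G v"
proof -
  let ?v = "\<Sum>e\<in>Poly_Mapping.keys v. Poly_Mapping.single e (Poly_Mapping.lookup v e)"
  have "F ?v = G ?v"
    by (simp add: additive.sum[OF assms(1)] additive.sum[OF assms(2)] assms(3))
  then show ?thesis by (simp flip: mpol_sum_singles)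
qed

lemma additive_cst: "additive cst"
  unfolding cst_def[abs_def] by (rule additive_single)

lemmas cst_add = additive.add[OF additive_cst]
  and cst_minus = additive.minus[OF additive_cst]
  and cst_diff = additive.diff[OF additive_cst]

lemma cst_0 [simp]: "cst 0 = 0"
  by (simp add: cst_def)

lemma cst_eq_iff [simp]: "cst a = cst b \<longleftrightarrow> a = b"
  unfolding cst_def by (metis lookup_single_eq)

lemma cst_1 [simp]: "cst 1 = 1"
  by (simp add: cst_def)

lemma cst_mult: "cst (a * b) = cst a * cst b"
  by (simp add: cst_def mult_single)

lemma lmono_mult: "lmono (a + b) = lmono a * lmono b"
  by (simp add: lmono_def mult_single)

lemma lmono_0: "lmono 0 = 1"
  by (simp add: lmono_def)

lemma lam_power: "lam i ^ n = lmono (Poly_Mapping.single i n)"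
proof (induction n)
  case 0
  show ?case by (simp add: lmono_0)
next
  case (Suc n)
  have "Poly_Mapping.single i (Suc n) = Poly_Mapping.single i 1 + Poly_Mapping.single i n"
    by (simp flip: single_add)
  then show ?case
    using Suc by (simp only: power_Suc lmono_mult lam_def)
qed

lemma prod_lmono: "(\<Prod>i\<in>I. lmono (x i)) = lmono (\<Sum>i\<in>I. x i)"
  by (induction I rule: infinite_finite_induct) (auto simp: lmono_0 lmono_mult)

section \<open>Scalar multiplication and substitution\<close>

locale poly_module = module s
  for s :: "'f::field poly \<Rightarrow> 'b::ab_group_add \<Rightarrow> 'b"
begin

lemma additive_scale_left: "additive (\<lambda>r. s r b)"
  by (simp add: additive_def scale_left_distrib)

lemma additive_scale_right: "additive (s r)"
  by (simp add: additive_def scale_right_distrib)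

lemma additive_pscale_right: "additive (pscale s p)"
  unfolding pscale_def[abs_def]
  by (intro additive_sum_fun additive_sum_keys additive_compose[OF additive_single]
      additive_scale_right)

lemma additive_pscale_left: "additive (\<lambda>p. pscale s p v)"
  unfolding pscale_def
  by (intro additive_sum_keys additive_sum_fun additive_compose[OF additive_single]
      additive_scale_left)

lemma pscale_single:
  "pscale s (Poly_Mapping.single e r) (Poly_Mapping.single e' b) =
    Poly_Mapping.single (e + e') (s r b)"
  unfolding pscale_def by (simp add: scale_zero_left)

lemma pscale_assoc: "pscale s p (pscale s p' v) = pscale s (p * p') v"
proof (rule additive_eqI[where v = p])
  show "additive (\<lambda>p. pscale s p (pscale s p' v))" by (rule additive_pscale_left)
  show "additive (\<lambda>p. pscale s (p * p') v)"
    by (simp add: additive_def distrib_right additive.add[OF additive_pscale_left])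
  fix e
  let ?p = "Poly_Mapping.single e (Poly_Mapping.lookup p e)"
  show "pscale s ?p (pscale s p' v) = pscale s (?p * p') v"
  proof (rule additive_eqI[where v = p'])
    show "additive (\<lambda>p'. pscale s ?p (pscale s p' v))"
      by (rule additive_compose[OF additive_pscale_right additive_pscale_left])
    show "additive (\<lambda>p'. pscale s (?p * p') v)"
      by (simp add: additive_def distrib_left additive.add[OF additive_pscale_left])
    fix e'
    let ?p' = "Poly_Mapping.single e' (Poly_Mapping.lookup p' e')"
    show "pscale s ?p (pscale s ?p' v) = pscale s (?p * ?p') v"
      by (rule additive_eqI[where v = v])
        (simp_all add: additive_def additive.add[OF additive_pscale_right]
          pscale_single mult_single ac_simps)
  qed
qed

lemma pscale_one [simp]: "pscale s 1 v = v"
proof (rule additive_eqI[where v = v, OF additive_pscale_right])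
  fix e
  have "pscale s (Poly_Mapping.single 0 1) (Poly_Mapping.single e (Poly_Mapping.lookup v e)) =
      Poly_Mapping.single e (Poly_Mapping.lookup v e)"
    unfolding pscale_single by simp
  then show "pscale s 1 (Poly_Mapping.single e (Poly_Mapping.lookup v e)) =
      Poly_Mapping.single e (Poly_Mapping.lookup v e)" by simp
qed (simp add: additive_def)

sublocale P: module "pscale s"
  by standard
    (simp_all add: additive.add[OF additive_pscale_left] additive.add[OF additive_pscale_right]
      pscale_assoc)

lemma pscale_left_commute: "pscale s p (pscale s p' v) = pscale s p' (pscale s p v)"
  by (simp add: pscale_assoc mult.commute)

lemma pscale_cst: "pscale s (cst r) (cst b) = cst (s r b)"
  by (simp add: cst_def pscale_single)

lemma pscale_lmono_single: "pscale s (lmono e) (Poly_Mapping.single e' b) = Poly_Mapping.single (e + e') b"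
  by (simp add: lmono_def pscale_single)

lemma pscale_lmono_cst: "pscale s (lmono e) (cst b) = Poly_Mapping.single e b"
  by (simp add: cst_def pscale_lmono_single)

lemma additive_psubst: "additive (psubst s ts)"
  unfolding psubst_def[abs_def]
  by (intro additive_sum_keys additive_compose[OF additive_pscale_right additive_cst])

lemma psubst_single:
  "psubst s ts (Poly_Mapping.single e b) =
    pscale s (\<Prod>i<length ts. (ts ! i) ^ Poly_Mapping.lookup e i) (cst b)"
  unfolding psubst_def by (simp add: P.scale_zero_right)

lemma psubst_cst: "psubst s ts (cst b) = cst b"
  by (simp add: cst_def psubst_single)

lemma ev_superset:
  assumes "degree P \<le> N"
  shows "ev s t P = (\<Sum>n\<le>N. pscale s (t ^ n) (cst (coeff P n)))"
  unfolding ev_def using assms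
  by (intro sum.mono_neutral_left) (auto simp: coeff_eq_0)

lemma additive_ev: "additive (ev s t)"
proof
  fix P Q :: "'b poly"
  let ?N = "max (degree P) (degree Q)"
  have "degree (P + Q) \<le> ?N" by (rule degree_add_le_max)
  then show "ev s t (P + Q) = ev s t P + ev s t Q"
    by (simp add: ev_superset[of _ ?N] cst_add P.scale_right_distrib sum.distrib)
qed

end

text \<open>
  The scalars themselves are polynomials with coefficients in the module F[d] over itself, so
  everything proved for modules holds for products and substitutions of scalars.
\<close>

interpretation coeffs: poly_module "(*) :: 'f::field poly \<Rightarrow> 'f poly \<Rightarrow> 'f poly"
  by standard (simp_all add: algebra_simps)

lemma pscale_times: "pscale (*) p q = p * (q :: 'f::field poly mpol)"
proof (rule additive_eqI[where v = p])
  show "additive (\<lambda>p. pscale (*) p q)" by (rule coeffs.additive_pscale_left)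
  show "additive (\<lambda>p. p * q)" by (simp add: additive_def distrib_right)
  fix e
  let ?p = "Poly_Mapping.single e (Poly_Mapping.lookup p e)"
  show "pscale (*) ?p q = ?p * q"
  proof (rule additive_eqI[where v = q, OF coeffs.additive_pscale_right])
  qed (simp_all add: additive_def distrib_left coeffs.pscale_single mult_single)
qed

abbreviation subst :: "'f::field poly mpol list \<Rightarrow> 'f poly mpol \<Rightarrow> 'f poly mpol" where
  "subst ts \<equiv> psubst (*) ts"

lemma subst_single:
  "subst ts (Poly_Mapping.single e r) =
    cst r * (\<Prod>i<length ts. (ts ! i) ^ Poly_Mapping.lookup e i)"
  by (simp add: coeffs.psubst_single pscale_times mult.commute)

lemma subst_cst: "subst ts (cst r) = cst r"
  by (rule coeffs.psubst_cst)

lemma subst_1: "subst ts 1 = 1"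
  using subst_cst[of ts 1] by simp

lemma subst_lam:
  assumes "i < length ts"
  shows "subst ts (lam i) = ts ! i"
proof -
  have "(\<Prod>j<length ts. (ts ! j) ^ Poly_Mapping.lookup (Poly_Mapping.single i 1) j) =
      (\<Prod>j<length ts. if j = i then ts ! i else 1)"
    by (intro prod.cong) (auto simp: lookup_single)
  also have "\<dots> = ts ! i" using assms by simp
  finally show ?thesis by (simp add: lam_def lmono_def subst_single)
qed

lemma subst_mult: "subst ts (p * q) = subst ts p * subst ts q"
proof (rule additive_eqI[where v = p])
  show "additive (\<lambda>p. subst ts (p * q))"
    by (rule additive_compose[OF coeffs.additive_psubst]) (simp add: additive_def distrib_right)
  show "additive (\<lambda>p. subst ts p * subst ts q)"
    by (simp add: additive_def distrib_right additive.add[OF coeffs.additive_psubst])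
  fix e
  let ?p = "Poly_Mapping.single e (Poly_Mapping.lookup p e)"
  show "subst ts (?p * q) = subst ts ?p * subst ts q"
  proof (rule additive_eqI[where v = q])
    show "additive (\<lambda>q. subst ts (?p * q))"
      by (rule additive_compose[OF coeffs.additive_psubst]) (simp add: additive_def distrib_left)
    show "additive (\<lambda>q. subst ts ?p * subst ts q)"
      by (simp add: additive_def distrib_left additive.add[OF coeffs.additive_psubst])
  qed (simp add: mult_single subst_single cst_mult lookup_add power_add prod.distrib ac_simps)
qed

lemma subst_power: "subst ts (p ^ n) = subst ts p ^ n"
  by (induction n) (simp_all add: subst_1 subst_mult)

lemma subst_prod: "subst ts (prod x I) = (\<Prod>i\<in>I. subst ts (x i))"
  by (induction I rule: infinite_finite_induct) (simp_all add: subst_1 subst_mult)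

context poly_module
begin

text \<open>
  Substitution is semilinear along the ring homomorphism that the same substitution induces on
  the scalars.
\<close>

lemma psubst_pscale: "psubst s ts (pscale s p v) = pscale s (subst ts p) (psubst s ts v)"
proof (rule additive_eqI[where v = p])
  show "additive (\<lambda>p. psubst s ts (pscale s p v))"
    by (rule additive_compose[OF additive_psubst additive_pscale_left])
  show "additive (\<lambda>p. pscale s (subst ts p) (psubst s ts v))"
    by (rule additive_compose[OF additive_pscale_left coeffs.additive_psubst])
  fix e
  let ?p = "Poly_Mapping.single e (Poly_Mapping.lookup p e)"
  show "psubst s ts (pscale s ?p v) = pscale s (subst ts ?p) (psubst s ts v)"
  proof (rule additive_eqI[where v = v])
    show "additive (\<lambda>v. psubst s ts (pscale s ?p v))"
      by (rule additive_compose[OF additive_psubst additive_pscale_right])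
    show "additive (\<lambda>v. pscale s (subst ts ?p) (psubst s ts v))"
      by (rule additive_compose[OF additive_pscale_right additive_psubst])
  qed (simp add: pscale_single psubst_single subst_single pscale_assoc lookup_add power_add
      prod.distrib ac_simps flip: pscale_cst)
qed

lemma psubst_psubst:
  "psubst s ts (psubst s us v) = psubst s (map (subst ts) us) v"
proof (rule additive_eqI[where v = v])
  show "additive (\<lambda>v. psubst s ts (psubst s us v))"
    by (rule additive_compose[OF additive_psubst additive_psubst])
qed (simp_all add: additive_psubst psubst_single psubst_pscale psubst_cst subst_prod subst_power)

lemma psubst_ev: "psubst s ts (ev s t P) = ev s (subst ts t) P"
  by (simp add: ev_def additive.sum[OF additive_psubst] psubst_pscale psubst_cst subst_power)

end

section \<open>Coefficients with respect to one variable\<close>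

text \<open>
  The coefficient of the \<open>n\<close>-th power of the \<open>j\<close>-th variable, as a polynomial in the others. For
  \<open>n = 1\<close> it is the derivative at 0 with respect to that variable.
\<close>

definition lcoeff :: "nat \<Rightarrow> nat \<Rightarrow> 'b::ab_group_add mpol \<Rightarrow> 'b mpol" where
  "lcoeff j n v = (\<Sum>e\<in>Poly_Mapping.keys v.
     if Poly_Mapping.lookup e j = n
     then Poly_Mapping.single (e - Poly_Mapping.single j n) (Poly_Mapping.lookup v e) else 0)"

lemma additive_lcoeff: "additive (lcoeff j n)"
  unfolding lcoeff_def[abs_def]
  by (rule additive_sum_keys) (simp add: additive_def single_add)

lemmas lcoeff_add = additive.add[OF additive_lcoeff]
  and lcoeff_0 [simp] = additive.zero[OF additive_lcoeff]
  and lcoeff_minus = additive.minus[OF additive_lcoeff]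
  and lcoeff_sum = additive.sum[OF additive_lcoeff]

lemma lcoeff_single:
  "lcoeff j n (Poly_Mapping.single e b) =
    (if Poly_Mapping.lookup e j = n then Poly_Mapping.single (e - Poly_Mapping.single j n) b else 0)"
  unfolding lcoeff_def by simp

lemma lcoeff_cst: "lcoeff j 0 (cst b) = cst b" "lcoeff j (Suc 0) (cst b) = 0"
  by (simp_all add: cst_def lcoeff_single)

text \<open>
  Constancy in the \<open>j\<close>-th variable, as far as the coefficients of degree 0 and 1 can tell. Since
  only these two coefficients are ever extracted, this weak form suffices, and it passes to sums
  and products by additivity and the two product rules below.
\<close>

definition free_of :: "nat \<Rightarrow> 'b::ab_group_add mpol \<Rightarrow> bool" where
  "free_of j v \<longleftrightarrow> lcoeff j 0 v = v \<and> lcoeff j 1 v = 0"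

lemma free_of_add: "free_of j u \<Longrightarrow> free_of j v \<Longrightarrow> free_of j (u + v)"
  and free_of_minus: "free_of j u \<Longrightarrow> free_of j (- u)"
  by (simp_all add: free_of_def lcoeff_add lcoeff_minus)

lemma free_of_sum: "(\<And>i. i \<in> I \<Longrightarrow> free_of j (v i)) \<Longrightarrow> free_of j (sum v I)"
  by (simp add: free_of_def lcoeff_sum)

lemma free_of_cst: "free_of j (cst b)"
  by (simp add: free_of_def lcoeff_cst)

definition vars_in :: "nat \<Rightarrow> 'b::zero mpol \<Rightarrow> bool" where
  "vars_in q v \<longleftrightarrow> (\<forall>e\<in>Poly_Mapping.keys v. Poly_Mapping.keys e \<subseteq> {..<q})"

lemma vars_in_keys_subset:
  "vars_in q v \<Longrightarrow> Poly_Mapping.keys w \<subseteq> Poly_Mapping.keys v \<Longrightarrow> vars_in q w"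
  by (auto simp: vars_in_def)

lemma vars_in_0 [simp]: "vars_in q 0"
  by (simp add: vars_in_def)

lemma vars_in_add: "vars_in q u \<Longrightarrow> vars_in q v \<Longrightarrow> vars_in q (u + v)"
  using keys_add[of u v] unfolding vars_in_def by blast

lemma vars_in_uminus:
  fixes u :: "'b::ab_group_add mpol"
  shows "vars_in q u \<Longrightarrow> vars_in q (- u)"
  by (erule vars_in_keys_subset) (auto simp: in_keys_iff)

lemma vars_in_diff:
  fixes u :: "'b::ab_group_add mpol"
  shows "vars_in q u \<Longrightarrow> vars_in q v \<Longrightarrow> vars_in q (u - v)"
  using vars_in_add[of q u "- v"] vars_in_uminus[of q v] by simp

lemma vars_in_sum: "(\<And>i. i \<in> I \<Longrightarrow> vars_in q (v i)) \<Longrightarrow> vars_in q (sum v I)"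
  by (induction I rule: infinite_finite_induct) (auto intro: vars_in_add)

lemma vars_in_lcoeff:
  assumes "vars_in (Suc p) v"
  shows "vars_in p (lcoeff p 1 v)"
  unfolding lcoeff_def
proof (rule vars_in_sum)
  fix e assume e: "e \<in> Poly_Mapping.keys v"
  have "Poly_Mapping.keys (e - Poly_Mapping.single p 1) \<subseteq> {..<p}"
    if *: "Poly_Mapping.lookup e p = 1"
  proof
    fix i assume "i \<in> Poly_Mapping.keys (e - Poly_Mapping.single p 1)"
    then have "Poly_Mapping.lookup e i \<noteq> 0" "i \<noteq> p"
      using * by (auto simp: in_keys_iff lookup_minus lookup_single when_def split: if_splits)
    moreover from this(1) have "i < Suc p"
      using assms e by (auto simp: vars_in_def in_keys_iff subset_iff)
    ultimately show "i \<in> {..<p}" by simp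
  qed
  then show "vars_in p (if Poly_Mapping.lookup e p = 1
      then Poly_Mapping.single (e - Poly_Mapping.single p 1) (Poly_Mapping.lookup v e) else 0)"
    by (auto simp: vars_in_def)
qed

lemma lmono_eq_prod:
  assumes "Poly_Mapping.keys e \<subseteq> {..<q}"
  shows "(\<Prod>i<q. lam i ^ Poly_Mapping.lookup e i) = lmono e"
proof -
  have "(\<Sum>i<q. Poly_Mapping.single i (Poly_Mapping.lookup e i)) = e"
    using assms
    by (intro poly_mapping_eqI) (auto simp: lookup_sum lookup_single when_def in_keys_iff)
  then show ?thesis by (simp add: lam_power prod_lmono)
qed

context poly_module
begin

text \<open>
  The coefficients of degree 0 and 1 obey the rules for the value and the derivative of a
  product at 0.
\<close>

lemma lcoeff_0_pscale:
  "lcoeff j 0 (pscale s p v) = pscale s (lcoeff j 0 p) (lcoeff j 0 v)"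
proof (rule additive_eqI[where v = p])
  show "additive (\<lambda>p. lcoeff j 0 (pscale s p v))"
    by (rule additive_compose[OF additive_lcoeff additive_pscale_left])
  show "additive (\<lambda>p. pscale s (lcoeff j 0 p) (lcoeff j 0 v))"
    by (rule additive_compose[OF additive_pscale_left additive_lcoeff])
  fix e
  let ?p = "Poly_Mapping.single e (Poly_Mapping.lookup p e)"
  show "lcoeff j 0 (pscale s ?p v) = pscale s (lcoeff j 0 ?p) (lcoeff j 0 v)"
  proof (rule additive_eqI[where v = v])
    show "additive (\<lambda>v. lcoeff j 0 (pscale s ?p v))"
      by (rule additive_compose[OF additive_lcoeff additive_pscale_right])
    show "additive (\<lambda>v. pscale s (lcoeff j 0 ?p) (lcoeff j 0 v))"
      by (rule additive_compose[OF additive_pscale_right additive_lcoeff])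
  qed (auto simp: pscale_single lcoeff_single lookup_add)
qed

lemma lcoeff_1_pscale:
  "lcoeff j (Suc 0) (pscale s p v) =
    pscale s (lcoeff j 1 p) (lcoeff j 0 v) + pscale s (lcoeff j 0 p) (lcoeff j 1 v)"
proof (rule additive_eqI[where v = p])
  show "additive (\<lambda>p. lcoeff j (Suc 0) (pscale s p v))"
    by (rule additive_compose[OF additive_lcoeff additive_pscale_left])
  show "additive (\<lambda>p. pscale s (lcoeff j 1 p) (lcoeff j 0 v) +
      pscale s (lcoeff j 0 p) (lcoeff j 1 v))"
    by (simp add: additive_def lcoeff_add P.scale_left_distrib)
  fix e
  let ?p = "Poly_Mapping.single e (Poly_Mapping.lookup p e)"
  show "lcoeff j (Suc 0) (pscale s ?p v) =
    pscale s (lcoeff j 1 ?p) (lcoeff j 0 v) + pscale s (lcoeff j 0 ?p) (lcoeff j 1 v)"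
  proof (rule additive_eqI[where v = v])
    show "additive (\<lambda>v. lcoeff j (Suc 0) (pscale s ?p v))"
      by (rule additive_compose[OF additive_lcoeff additive_pscale_right])
    show "additive (\<lambda>v. pscale s (lcoeff j 1 ?p) (lcoeff j 0 v) +
        pscale s (lcoeff j 0 ?p) (lcoeff j 1 v))"
      by (simp add: additive_def lcoeff_add P.scale_right_distrib)
    fix e'
    let ?v = "Poly_Mapping.single e' (Poly_Mapping.lookup v e')"
    have "e + e' - Poly_Mapping.single j (Suc 0) = (e - Poly_Mapping.single j (Suc 0)) + e'"
      if "Poly_Mapping.lookup e j = Suc 0" for e e' :: "nat \<Rightarrow>\<^sub>0 nat"
      using that
      by (intro poly_mapping_eqI) (auto simp: lookup_add lookup_minus lookup_single when_def)
    from this[of e e'] this[of e' e]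
    show "lcoeff j (Suc 0) (pscale s ?p ?v) =
      pscale s (lcoeff j 1 ?p) (lcoeff j 0 ?v) + pscale s (lcoeff j 0 ?p) (lcoeff j 1 ?v)"
      by (auto simp: pscale_single lcoeff_single lookup_add add_is_1 ac_simps)
  qed
qed

lemma free_of_pscale: "free_of j p \<Longrightarrow> free_of j v \<Longrightarrow> free_of j (pscale s p v)"
  by (simp add: free_of_def lcoeff_0_pscale lcoeff_1_pscale)

end

lemma lcoeff_0_mult:
  fixes p q :: "'f::field poly mpol"
  shows "lcoeff j 0 (p * q) = lcoeff j 0 p * lcoeff j 0 q"
  using coeffs.lcoeff_0_pscale[of j p q] by (simp add: pscale_times)

lemma lcoeff_1_mult:
  fixes p q :: "'f::field poly mpol"
  shows "lcoeff j (Suc 0) (p * q) = lcoeff j 1 p * lcoeff j 0 q + lcoeff j 0 p * lcoeff j 1 q"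
  using coeffs.lcoeff_1_pscale[of j p q] by (simp add: pscale_times)

lemma lcoeff_of_1: "lcoeff j 0 (1 :: 'f::field poly mpol) = 1"
  "lcoeff j (Suc 0) (1 :: 'f::field poly mpol) = 0"
  using lcoeff_cst[of j "1 :: 'f poly"] by simp_all

lemma free_of_1: "free_of j (1 :: 'f::field poly mpol)"
  by (simp add: free_of_def lcoeff_of_1)

lemma free_of_mult:
  fixes p q :: "'f::field poly mpol"
  shows "free_of j p \<Longrightarrow> free_of j q \<Longrightarrow> free_of j (p * q)"
  using coeffs.free_of_pscale[of j p q] by (simp add: pscale_times)

lemma free_of_power:
  fixes p :: "'f::field poly mpol"
  shows "free_of j p \<Longrightarrow> free_of j (p ^ n)"
  by (induction n) (simp_all add: free_of_1 free_of_mult)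

lemma free_of_prod:
  fixes p :: "'i \<Rightarrow> 'f::field poly mpol"
  shows "(\<And>i. i \<in> I \<Longrightarrow> free_of j (p i)) \<Longrightarrow> free_of j (prod p I)"
  by (induction I rule: infinite_finite_induct) (simp_all add: free_of_1 free_of_mult)

lemma lcoeff_lam_power:
  "lcoeff j n (lam j ^ m) = (if m = n then 1 else (0 :: 'f::field poly mpol))"
  by (simp add: lam_power lmono_def lcoeff_single flip: single_diff)

lemma free_of_lam: "i \<noteq> j \<Longrightarrow> free_of j (lam i)"
  by (simp add: free_of_def lam_def lmono_def lcoeff_single lookup_single)

lemma free_of_dd: "free_of j dd"
  by (simp add: dd_def free_of_cst)

lemma lcoeff_shifted_power:
  fixes x :: "'f::field poly mpol"
  assumes "free_of j x"
  shows "lcoeff j 0 ((x + lam j) ^ m) = x ^ m"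
    and "lcoeff j 1 ((x + lam j) ^ m) = of_nat m * x ^ (m - 1)"
proof -
  have x: "lcoeff j 0 (x + lam j) = x" "lcoeff j (Suc 0) (x + lam j) = 1"
    using assms lcoeff_lam_power[of j 0 1] lcoeff_lam_power[of j 1 1]
    by (simp_all add: free_of_def lcoeff_add)
  show 0: "lcoeff j 0 ((x + lam j) ^ m) = x ^ m" for m
    by (induction m) (simp_all add: lcoeff_of_1 lcoeff_0_mult x)
  show "lcoeff j 1 ((x + lam j) ^ m) = of_nat m * x ^ (m - 1)"
  proof (induction m)
    case (Suc m)
    have "lcoeff j 1 ((x + lam j) ^ Suc m) = x ^ m + x * (of_nat m * x ^ (m - 1))"
      using Suc by (simp add: lcoeff_1_mult x 0)
    then show ?case
      by (cases m) (simp_all add: algebra_simps)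
  qed (simp add: lcoeff_of_1)
qed

context poly_module
begin

lemma free_of_ev: "free_of j t \<Longrightarrow> free_of j (ev s t P)"
  unfolding ev_def by (intro free_of_sum free_of_pscale free_of_power free_of_cst)

lemma lcoeff_ev_lam: "lcoeff j n (ev s (lam j) P) = cst (coeff P n)" if "n = 0 \<or> n = 1"
proof -
  have "lcoeff j n (pscale s (lam j ^ m) (cst (coeff P m))) =
      (if m = n then cst (coeff P n) else 0)" for m
    using that lcoeff_lam_power[of j "Suc 0" "Suc 0", where ?'f = 'f]
    by (auto simp: lcoeff_0_pscale lcoeff_1_pscale lcoeff_lam_power lcoeff_cst)
  then show ?thesis
    by (simp add: ev_superset[of P "max n (degree P)"] lcoeff_sum)
qed

text \<open>
  Each term becomes the product of a factor without \<open>lam j\<close> and the power of \<open>lam j\<close> to which the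
  last variable occurred, so the linear coefficient can be taken before or after substituting.
  This lets the contraction pass through the arguments of the differential.
\<close>

lemma lcoeff_psubst_last:
  assumes "\<And>u. u \<in> set us \<Longrightarrow> free_of j u"
  shows "lcoeff j 1 (psubst s (us @ [lam j]) v) = psubst s us (lcoeff (length us) 1 v)"
proof (rule additive_eqI[where v = v])
  let ?p = "length us"
  show "additive (\<lambda>v. lcoeff j 1 (psubst s (us @ [lam j]) v))"
    by (rule additive_compose[OF additive_lcoeff additive_psubst])
  show "additive (\<lambda>v. psubst s us (lcoeff (length us) 1 v))"
    by (rule additive_compose[OF additive_psubst additive_lcoeff])
  fix e
  let ?U = "\<Prod>i<?p. us ! i ^ Poly_Mapping.lookup e i"
  let ?b = "Poly_Mapping.lookup v e"
  have U: "(\<Prod>i<length (us @ [lam j]). (us @ [lam j]) ! i ^ Poly_Mapping.lookup e i) =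
      ?U * lam j ^ Poly_Mapping.lookup e ?p"
    by (simp add: nth_append)
  have f: "free_of j ?U"
    using assms by (intro free_of_prod free_of_power) auto
  have "(\<Prod>i<?p. us ! i ^ Poly_Mapping.lookup (e - Poly_Mapping.single ?p 1) i) = ?U"
    by (intro prod.cong) (auto simp: lookup_minus lookup_single)
  then show "lcoeff j 1 (psubst s (us @ [lam j]) (Poly_Mapping.single e ?b)) =
      psubst s us (lcoeff ?p 1 (Poly_Mapping.single e ?b))"
    unfolding psubst_single U lcoeff_single using f additive.zero[OF additive_psubst]
    by (simp add: psubst_single lcoeff_1_pscale lcoeff_cst lcoeff_1_mult lcoeff_lam_power
        lcoeff_single free_of_def)
qed

lemma psubst_ident:
  assumes "vars_in q v"
  shows "psubst s (map lam [0..<q]) v = v"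
proof (rule additive_eqI[where v = v, OF additive_psubst])
  fix e assume "e \<in> Poly_Mapping.keys v"
  then have "Poly_Mapping.keys e \<subseteq> {..<q}" using assms by (auto simp: vars_in_def)
  from lmono_eq_prod[OF this, where ?'a = 'f]
  show "psubst s (map lam [0..<q]) (Poly_Mapping.single e (Poly_Mapping.lookup v e)) =
    Poly_Mapping.single e (Poly_Mapping.lookup v e)"
    by (simp add: psubst_single pscale_lmono_cst)
qed (simp add: additive_def)

lemma additive_pd: "additive (pd s i)"
  unfolding pd_def[abs_def] fscale_def
  by (intro additive_sum_keys additive_compose[OF additive_single additive_scale_right])

lemma pd_single:
  "pd s i (Poly_Mapping.single e b) =
    Poly_Mapping.single (e - Poly_Mapping.single i 1) (s (of_nat (Poly_Mapping.lookup e i)) b)"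
  unfolding pd_def by (simp add: fscale_def of_nat_poly)

text \<open>
  Taylor expansion to first order in \<open>lam q\<close> of a polynomial whose \<open>k\<close>-th variable is shifted by
  the fresh variable \<open>lam q\<close>. This produces the Euler terms of the energy operator.
\<close>

lemma lcoeff_psubst_shift:
  assumes "vars_in q v" "k < q"
  shows "lcoeff q 0 (psubst s ((map lam [0..<q])[k := lam k + lam q]) v) = v"
    and "lcoeff q 1 (psubst s ((map lam [0..<q])[k := lam k + lam q]) v) = pd s k v"
proof -
  let ?ts = "(map lam [0..<q])[k := lam k + lam q] :: 'f poly mpol list"
  have a: "additive (\<lambda>v. lcoeff q n (psubst s ?ts v))" for n
    by (rule additive_compose[OF additive_lcoeff additive_psubst])
  {
    fix e assume e: "e \<in> Poly_Mapping.keys v"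
    let ?n = "Poly_Mapping.lookup e k"
    let ?U = "(\<Prod>i\<in>{..<q} - {k}. lam i ^ Poly_Mapping.lookup e i) :: 'f poly mpol"
    have split: "(\<Prod>i<q. g i) = g k * (\<Prod>i\<in>{..<q} - {k}. g i)" for g :: "nat \<Rightarrow> 'f poly mpol"
      using \<open>k < q\<close> by (simp add: prod.remove)
    have eq: "(\<Prod>i<length ?ts. ?ts ! i ^ Poly_Mapping.lookup e i) = (lam k + lam q) ^ ?n * ?U"
      unfolding length_list_update length_map length_upt diff_zero split using \<open>k < q\<close>
      by simp
    have f: "free_of q ?U"
      by (intro free_of_prod free_of_power free_of_lam) auto
    have fk: "free_of q (lam k :: 'f poly mpol)"
      using \<open>k < q\<close> by (intro free_of_lam) auto
    have l: "lam k ^ ?n * ?U = lmono e"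
      using lmono_eq_prod[of e q, where ?'a = 'f] assms e by (simp add: split vars_in_def)
    have l1: "lam k ^ (?n - 1) * ?U = lmono (e - Poly_Mapping.single k 1)" if "?n \<noteq> 0"
    proof -
      have "?U = (\<Prod>i\<in>{..<q} - {k}. lam i ^ Poly_Mapping.lookup (e - Poly_Mapping.single k 1) i)"
        by (intro prod.cong) (auto simp: lookup_minus lookup_single)
      moreover have "Poly_Mapping.keys (e - Poly_Mapping.single k 1) \<subseteq> {..<q}"
        using assms e by (auto simp: vars_in_def in_keys_iff lookup_minus subset_iff)
      ultimately show ?thesis
        using lmono_eq_prod[of "e - Poly_Mapping.single k 1" q, where ?'a = 'f]
        by (simp add: split lookup_minus)
    qed
    have "lcoeff q 0 (psubst s ?ts (Poly_Mapping.single e b)) = Poly_Mapping.single e b" for b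
      unfolding psubst_single eq using f lcoeff_shifted_power[OF fk]
      by (simp add: lcoeff_0_pscale lcoeff_0_mult lcoeff_cst free_of_def l pscale_lmono_cst)
    moreover have "lcoeff q 1 (psubst s ?ts (Poly_Mapping.single e b)) =
        pd s k (Poly_Mapping.single e b)" for b
    proof -
      have "lcoeff q 1 (psubst s ?ts (Poly_Mapping.single e b)) =
          pscale s (of_nat ?n * (lam k ^ (?n - 1) * ?U)) (cst b)"
        unfolding psubst_single eq using f lcoeff_shifted_power[OF fk]
        by (simp add: lcoeff_1_pscale lcoeff_1_mult lcoeff_cst free_of_def mult.assoc)
      also have "\<dots> = pd s k (Poly_Mapping.single e b)"
      proof (cases "?n = 0")
        case False
        have "of_nat ?n * (lam k ^ (?n - 1) * ?U) =
            Poly_Mapping.single (e - Poly_Mapping.single k 1) (of_nat ?n)"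
          unfolding l1[OF False] by (simp add: lmono_def mult_single flip: single_of_nat)
        then show ?thesis by (simp only: pd_single cst_def pscale_single) simp
      qed (simp add: pd_single)
      finally show ?thesis .
    qed
    note calculation this
  } note singles = this
  show "lcoeff q 0 (psubst s ?ts v) = v"
    by (rule additive_eqI[where v = v, OF a]) (simp_all add: additive_def singles)
  show "lcoeff q 1 (psubst s ?ts v) = pd s k v"
    by (rule additive_eqI[where v = v, OF a]) (simp_all only: additive_pd singles)
qed

end

section \<open>The lambda-action on polynomials\<close>

context poly_module
begin

lemma lprod_cst:
  assumes "\<And>b. br 0 b = 0"
  shows "lprod s br t (cst a) v =
    (\<Sum>e\<in>Poly_Mapping.keys v. pscale s (lmono e) (ev s t (br a (Poly_Mapping.lookup v e))))"
  by (cases "a = 0")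
    (simp_all add: lprod_def cst_def assms additive.zero[OF additive_ev] P.scale_zero_right)

lemma additive_lprod_cst:
  assumes "\<And>b. br 0 b = 0" "additive (br a)"
  shows "additive (lprod s br t (cst a))"
  unfolding lprod_cst[where br = br, OF assms(1)]
  by (intro additive_sum_keys additive_compose[OF additive_pscale_right]
      additive_compose[OF additive_ev assms(2)])

lemma lprod_cst_single:
  assumes "\<And>b. br 0 b = 0" "additive (br a)"
  shows "lprod s br t (cst a) (Poly_Mapping.single e b) = pscale s (lmono e) (ev s t (br a b))"
  unfolding lprod_cst[where br = br, OF assms(1)]
  by (simp add: additive.zero[OF assms(2)] additive.zero[OF additive_ev] P.scale_zero_right)

lemma lcoeff_lprod:
  assumes "\<And>b. br 0 b = 0" "additive (br a)" "free_of j t"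
  shows "lcoeff j 1 (lprod s br t (cst a) v) = lprod s br t (cst a) (lcoeff j 1 v)"
proof (rule additive_eqI[where v = v])
  show "additive (\<lambda>v. lcoeff j 1 (lprod s br t (cst a) v))"
    by (rule additive_compose[OF additive_lcoeff additive_lprod_cst[where br = br, OF assms(1,2)]])
  show "additive (\<lambda>v. lprod s br t (cst a) (lcoeff j 1 v))"
    by (rule additive_compose[OF additive_lprod_cst[where br = br, OF assms(1,2)] additive_lcoeff])
  fix e
  show "lcoeff j 1 (lprod s br t (cst a) (Poly_Mapping.single e (Poly_Mapping.lookup v e))) =
    lprod s br t (cst a) (lcoeff j 1 (Poly_Mapping.single e (Poly_Mapping.lookup v e)))"
    using free_of_ev[OF assms(3), of "br a (Poly_Mapping.lookup v e)"]
      additive.zero[OF additive_lprod_cst[where br = br, OF assms(1,2)]]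
    by (simp add: lprod_cst_single[where br = br, OF assms(1,2)] lcoeff_single lmono_def lcoeff_1_pscale
        free_of_def)
qed

lemma additive_map_mpol:
  assumes "additive T"
  shows "additive (Poly_Mapping.map T)"
proof
  fix u v
  show "Poly_Mapping.map T (u + v) = Poly_Mapping.map T u + Poly_Mapping.map T v"
    by (rule poly_mapping_eqI)
      (auto simp: map.rep_eq lookup_add additive.add[OF assms] additive.zero[OF assms] when_def
        simp flip: additive.add[OF assms])
qed

lemma additive_L1: "additive (br a) \<Longrightarrow> additive (L1 br a)"
  by (simp add: additive_def L1_def)

text \<open>
  The linear coefficient of the lambda-action at a fresh variable is the operator \<open>L1\<close> applied to
  all coefficients; with L as the acting element this is the first term of the energy operator.
\<close>

lemma lcoeff_lprod_lam:
  assumes "\<And>b. br 0 b = 0" "additive (br a)" "vars_in j v"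
  shows "lcoeff j 1 (lprod s br (lam j) (cst a) v) = Poly_Mapping.map (L1 br a) v"
proof (rule additive_eqI[where v = v])
  show "additive (\<lambda>v. lcoeff j 1 (lprod s br (lam j) (cst a) v))"
    by (rule additive_compose[OF additive_lcoeff additive_lprod_cst[where br = br, OF assms(1,2)]])
  show "additive (Poly_Mapping.map (L1 br a))"
    by (rule additive_map_mpol[OF additive_L1[where br = br, OF assms(2)]])
  fix e assume "e \<in> Poly_Mapping.keys v"
  then have "Poly_Mapping.lookup e j = 0"
    using assms(3) by (auto simp: vars_in_def simp flip: not_in_keys_iff_lookup_eq_zero)
  then have "lcoeff j 0 (lmono e :: 'f poly mpol) = lmono e"
    "lcoeff j (Suc 0) (lmono e :: 'f poly mpol) = 0"
    by (simp_all add: lmono_def lcoeff_single)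
  moreover have "Poly_Mapping.map (L1 br a) (Poly_Mapping.single e b) =
      Poly_Mapping.single e (L1 br a b)" for b
    using additive.zero[OF additive_L1[where br = br, OF assms(2)]]
      additive.zero[OF additive_map_mpol[OF additive_L1[where br = br, OF assms(2)]]]
    by (cases "b = 0") simp_all
  ultimately show "lcoeff j 1 (lprod s br (lam j) (cst a) (Poly_Mapping.single e (Poly_Mapping.lookup v e))) =
    Poly_Mapping.map (L1 br a) (Poly_Mapping.single e (Poly_Mapping.lookup v e))"
    using lcoeff_ev_lam[of 1 j]
    by (simp add: lprod_cst_single[where br = br, OF assms(1,2)] lcoeff_1_pscale L1_def pscale_lmono_cst)
qed

lemma ev_scale: "ev s t (map_poly (fscale s c) P) = pscale s (cst [:c:]) (ev s t P)"
proof -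
  have d: "degree (map_poly (fscale s c) P) \<le> degree P"
    by (rule map_poly_degree_leq)
  show ?thesis
    unfolding ev_superset[OF d] ev_def[of s t P]
    by (simp add: P.scale_sum_right coeff_map_poly fscale_def pscale_assoc mult.commute
        flip: pscale_cst)
qed

lemma lprod_scale:
  assumes "\<And>b. br 0 b = 0" "additive (br a)"
    and "\<And>b. br a (fscale s c b) = map_poly (fscale s c) (br a b)"
  shows "lprod s br t (cst a) (pscale s (cst [:c:]) v) =
    pscale s (cst [:c:]) (lprod s br t (cst a) v)"
proof (rule additive_eqI[where v = v])
  show "additive (\<lambda>v. lprod s br t (cst a) (pscale s (cst [:c:]) v))"
    by (rule additive_compose[OF additive_lprod_cst[where br = br, OF assms(1,2)] additive_pscale_right])
  show "additive (\<lambda>v. pscale s (cst [:c:]) (lprod s br t (cst a) v))"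
    by (rule additive_compose[OF additive_pscale_right additive_lprod_cst[where br = br, OF assms(1,2)]])
  fix e
  have "pscale s (cst [:c:]) (Poly_Mapping.single e b) = Poly_Mapping.single e (fscale s c b)" for b
    by (simp add: cst_def pscale_single fscale_def)
  then show "lprod s br t (cst a) (pscale s (cst [:c:]) (Poly_Mapping.single e (Poly_Mapping.lookup v e))) =
    pscale s (cst [:c:]) (lprod s br t (cst a) (Poly_Mapping.single e (Poly_Mapping.lookup v e)))"
    by (simp add: lprod_cst_single[where br = br, OF assms(1,2)] assms(3) ev_scale pscale_assoc mult.commute)
qed

end

context poly_module
begin

lemma vector_space_fscale: "vector_space (fscale s)"
proof
  fix a b :: 'f and x y :: 'b
  show "fscale s a (x + y) = fscale s a x + fscale s a y"
    by (simp add: fscale_def scale_right_distrib)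
  show "fscale s (a + b) x = fscale s a x + fscale s b x"
    by (simp add: fscale_def flip: scale_left_distrib)
  show "fscale s a (fscale s b x) = fscale s (a * b) x"
    by (simp add: fscale_def mult.commute)
  show "fscale s 1 x = x"
    by (simp add: fscale_def flip: one_pCons)
qed

lemma vector_space_pscale_cst: "vector_space (\<lambda>c. pscale s (cst [:c:]))"
proof
  fix a b :: 'f and x y :: "'b mpol"
  show "pscale s (cst [:a:]) (x + y) = pscale s (cst [:a:]) x + pscale s (cst [:a:]) y"
    by (rule P.scale_right_distrib)
  show "pscale s (cst [:a + b:]) x = pscale s (cst [:a:]) x + pscale s (cst [:b:]) x"
    by (simp flip: P.scale_left_distrib cst_add)
  show "pscale s (cst [:a:]) (pscale s (cst [:b:]) x) = pscale s (cst [:a * b:]) x"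
    by (simp add: pscale_assoc mult.commute flip: cst_mult)
  show "pscale s (cst [:1:]) x = x"
    by (simp flip: one_pCons)
qed

lemma fscale_0: "fscale s c 0 = 0"
  by (simp add: fscale_def scale_zero_right)

lemma lcoeff_pscale_free: "free_of j p \<Longrightarrow> lcoeff j 1 (pscale s p v) = pscale s p (lcoeff j 1 v)"
  by (simp add: lcoeff_1_pscale free_of_def)

lemma keys_pscale_cst: "Poly_Mapping.keys (pscale s (cst r) v) \<subseteq> Poly_Mapping.keys v"
proof -
  have "pscale s (cst r) v =
      (\<Sum>e\<in>Poly_Mapping.keys v. Poly_Mapping.single e (s r (Poly_Mapping.lookup v e)))"
    by (subst mpol_sum_singles[of v])
      (simp add: additive.sum[OF additive_pscale_right] cst_def pscale_single)
  also have "Poly_Mapping.keys \<dots> \<subseteq> Poly_Mapping.keys v"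
    by (auto simp: in_keys_iff lookup_sum lookup_single when_def scale_zero_right split: if_splits)
  finally show ?thesis .
qed

end

lemma permutes_lessThan: "\<pi> permutes {..<q} \<Longrightarrow> i < q \<Longrightarrow> \<pi> i < (q :: nat)"
  using permutes_in_image[of \<pi> "{..<q}" i] by simp

lemma nths_Compl_singleton:
  assumes "k < length xs"
  shows "nths xs (- {k}) = take k xs @ drop (Suc k) xs"
proof -
  have "nths xs (- {k}) = nths (take k xs @ xs ! k # drop (Suc k) xs) (- {k})"
    using id_take_nth_drop[OF assms] by simp
  also have "\<dots> = take k xs @ drop (Suc k) xs"
    using assms by (auto simp: nths_append nths_Cons nths_all)
  finally show ?thesis .
qed

section \<open>Cochains and their evaluation\<close>

locale cochain_modules = A: poly_module sA + M: poly_module sM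
  for sA :: "'f::field poly \<Rightarrow> 'a::ab_group_add \<Rightarrow> 'a"
    and sM :: "'f poly \<Rightarrow> 'm::ab_group_add \<Rightarrow> 'm"
begin

lemma cochains_iff:
  "f \<in> cochains sA sM q \<longleftrightarrow>
     (\<forall>as. length as \<noteq> q \<longrightarrow> f as = 0) \<and>
     (\<forall>as. vars_in q (f as)) \<and>
     (\<forall>as i a b. length as = q \<longrightarrow> i < q \<longrightarrow> f (as[i := a + b]) = f (as[i := a]) + f (as[i := b])) \<and>
     (\<forall>as i c a. length as = q \<longrightarrow> i < q \<longrightarrow>
        f (as[i := fscale sA c a]) = pscale sM (cst [:c:]) (f (as[i := a]))) \<and>
     (\<forall>as i. length as = q \<longrightarrow> i < q \<longrightarrow>
        f (as[i := del sA (as ! i)]) = pscale sM (- lam i) (f as)) \<and>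
     (\<forall>as \<pi>. length as = q \<longrightarrow> \<pi> permutes {..<q} \<longrightarrow>
        psubst sM (permute_list \<pi> (map lam [0..<q])) (f (permute_list \<pi> as)) =
          pscale sM (of_int (sign \<pi>)) (f as))"
  unfolding cochains_def Vector_Spaces.linear_iff vars_in_def
  by (simp only: mem_Collect_eq A.vector_space_fscale M.vector_space_pscale_cst simp_thms
      all_simps all_conj_distrib imp_conjL imp_conjR conj_assoc)

context
  fixes f q
  assumes f: "f \<in> cochains sA sM q"
begin

lemma cochain_wrong_length: "length as \<noteq> q \<Longrightarrow> f as = 0"
  using f[unfolded cochains_iff, THEN conjunct1] by simp

lemma cochain_vars_in: "vars_in q (f as)"
  using f[unfolded cochains_iff, THEN conjunct2, THEN conjunct1] by simp

lemma cochain_add: "length as = q \<Longrightarrow> i < q \<Longrightarrow>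
    f (as[i := a + b]) = f (as[i := a]) + f (as[i := b])"
  using f[unfolded cochains_iff, THEN conjunct2, THEN conjunct2, THEN conjunct1] by simp

lemma cochain_scale: "length as = q \<Longrightarrow> i < q \<Longrightarrow>
    f (as[i := fscale sA c a]) = pscale sM (cst [:c:]) (f (as[i := a]))"
  using f[unfolded cochains_iff, THEN conjunct2, THEN conjunct2, THEN conjunct2, THEN conjunct1]
  by simp

lemma cochain_del: "length as = q \<Longrightarrow> i < q \<Longrightarrow>
    f (as[i := del sA (as ! i)]) = pscale sM (- lam i) (f as)"
  using f[unfolded cochains_iff, THEN conjunct2, THEN conjunct2, THEN conjunct2, THEN conjunct2,
      THEN conjunct1] by simp

lemma cochain_skew: "length as = q \<Longrightarrow> \<pi> permutes {..<q} \<Longrightarrow>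
    psubst sM (permute_list \<pi> (map lam [0..<q])) (f (permute_list \<pi> as)) =
      pscale sM (of_int (sign \<pi>)) (f as)"
  using f[unfolded cochains_iff, THEN conjunct2, THEN conjunct2, THEN conjunct2, THEN conjunct2,
      THEN conjunct2] by blast

lemma cochain_del': "length as = q \<Longrightarrow> i < q \<Longrightarrow>
    f (as[i := del sA a]) = pscale sM (- lam i) (f (as[i := a]))"
  using cochain_del[of "as[i := a]" i] by simp

lemma cochain_additive_first: "additive (\<lambda>a. f (a # as))"
proof
  fix a b
  show "f ((a + b) # as) = f (a # as) + f (b # as)"
  proof (cases "Suc (length as) = q")
    case True
    then show ?thesis using cochain_add[of "0 # as" 0 a b] by auto
  qed (simp add: cochain_wrong_length)
qed

text \<open>
  Skew-symmetry for arbitrary values of the variables: substitute \<open>ts\<close> in the identity that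
  defines skew-symmetry.
\<close>

lemma cochain_permute:
  assumes "length ts = q" "length as = q" "\<pi> permutes {..<q}"
  shows "psubst sM (permute_list \<pi> ts) (f (permute_list \<pi> as)) =
    pscale sM (of_int (sign \<pi>)) (psubst sM ts (f as))"
proof -
  have "psubst sM ts (psubst sM (permute_list \<pi> (map lam [0..<q])) (f (permute_list \<pi> as))) =
      pscale sM (subst ts (of_int (sign \<pi>))) (psubst sM ts (f as))"
    by (simp only: cochain_skew[OF assms(2,3)] M.psubst_pscale)
  moreover have "map (subst ts) (permute_list \<pi> (map lam [0..<q])) = permute_list \<pi> ts"
    using assms permutes_lessThan[OF assms(3)]
    by (intro nth_equalityI) (auto simp: permute_list_nth subst_lam)
  moreover have "subst ts (of_int (sign \<pi>)) = of_int (sign \<pi>)"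
    using subst_cst[of ts "of_int (sign \<pi>)"] by (simp add: cst_def)
  ultimately show ?thesis by (simp add: M.psubst_psubst)
qed

lemma cochain_swap_adjacent:
  assumes "length us = length as" "length us + length us' + 2 = q" "length us' = length as'"
  shows "psubst sM (us @ t # t' # us') (f (as @ a # a' # as')) =
    - psubst sM (us @ t' # t # us') (f (as @ a' # a # as'))"
proof -
  let ?k = "length us"
  let ?\<pi> = "transpose ?k (Suc ?k)"
  have p: "?\<pi> permutes {..<q}"
    using assms by (intro permutes_swap_id) auto
  have perm: "permute_list ?\<pi> (xs @ y # x # ys) = xs @ x # y # ys"
    if "length xs = ?k" "length xs + length ys + 2 = q" for xs ys and x y :: 'x
  proof (rule nth_equalityI)
    fix i assume "i < length (permute_list ?\<pi> (xs @ y # x # ys))"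
    then have "permute_list ?\<pi> (xs @ y # x # ys) ! i = (xs @ y # x # ys) ! ?\<pi> i"
      using that p by (intro permute_list_nth) simp_all
    then show "permute_list ?\<pi> (xs @ y # x # ys) ! i = (xs @ x # y # ys) ! i"
      using that(1) by (simp add: transpose_def nth_append nth_Cons')
  qed simp
  have "permute_list ?\<pi> (us @ t' # t # us') = us @ t # t' # us'"
    "permute_list ?\<pi> (as @ a' # a # as') = as @ a # a' # as'"
    by (rule perm; use assms in simp)+
  then show ?thesis
    using cochain_permute[of "us @ t' # t # us'" "as @ a' # a # as'" ?\<pi>] assms p
    by (simp add: sign_swap_id)
qed

text \<open>
  Moving one argument, together with its variable, past \<open>n\<close> others takes \<open>n\<close> adjacent
  transpositions. The prefixes \<open>ws\<close> and \<open>bs\<close> are there for the induction.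
\<close>

lemma cochain_move:
  assumes "length us = length as" "length ws = length bs" "length us' = length as'"
    and "length ws + length us + length us' + 1 = q"
  shows "psubst sM (ws @ t # us @ us') (f (bs @ a # as @ as')) =
    pscale sM ((-1) ^ length as) (psubst sM (ws @ us @ t # us') (f (bs @ as @ a # as')))"
  using assms
proof (induction us as arbitrary: ws bs rule: list_induct2)
  case Nil
  then show ?case by simp
next
  case (Cons u us b as)
  have "psubst sM (ws @ t # (u # us) @ us') (f (bs @ a # (b # as) @ as')) =
      - psubst sM (ws @ u # t # us @ us') (f (bs @ b # a # as @ as'))"
    unfolding append_Cons using Cons.prems Cons.hyps
    by (intro cochain_swap_adjacent) simp_all
  also have "psubst sM (ws @ u # t # us @ us') (f (bs @ b # a # as @ as')) =
      pscale sM ((-1) ^ length as) (psubst sM (ws @ u # us @ t # us') (f (bs @ b # as @ a # as')))"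
    using Cons.IH[of "ws @ [u]" "bs @ [b]"] Cons.prems by simp
  finally show ?case by (simp add: M.P.scale_minus_left)
qed

end

lemma cochain_first_to_nth:
  assumes f: "f \<in> cochains sA sM q" and "length as = q" "length us = q" "k < q"
  shows "psubst sM (t # nths us (- {k})) (f (a # nths as (- {k}))) =
    pscale sM ((-1) ^ k) (psubst sM (us[k := t]) (f (as[k := a])))"
  using cochain_move[OF f, of "take k us" "take k as" "[]" "[]" "drop (Suc k) us" "drop (Suc k) as" t a]
    assms by (simp add: nths_Compl_singleton upd_conv_take_nth_drop min_def)

lemma additive_apply_first:
  assumes "additive (\<lambda>a. f (a # as))"
  shows "additive (\<lambda>u. apply_first sM f ts u as)"
  unfolding apply_first_def
  by (intro additive_sum_keys additive_compose[OF M.additive_pscale_right]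
      additive_compose[OF M.additive_psubst assms])

lemma apply_first_single:
  assumes "additive (\<lambda>a. f (a # as))"
  shows "apply_first sM f ts (Poly_Mapping.single e a) as =
    pscale sM (lmono e) (psubst sM ts (f (a # as)))"
  unfolding apply_first_def
  by (simp add: additive.zero[OF assms] additive.zero[OF M.additive_psubst] M.P.scale_zero_right)

lemma apply_first_cst:
  assumes "additive (\<lambda>a. f (a # as))"
  shows "apply_first sM f ts (cst a) as = psubst sM ts (f (a # as))"
  by (simp add: cst_def apply_first_single[OF assms] lmono_0)

lemma apply_first_lam:
  assumes "additive (\<lambda>a. f (a # as))"
  shows "apply_first sM f ts (pscale sA (lmono d) u) as =
    pscale sM (lmono d) (apply_first sM f ts u as)"
proof (rule additive_eqI[where v = u])
  show "additive (\<lambda>u. apply_first sM f ts (pscale sA (lmono d) u) as)"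
    by (rule additive_compose[OF additive_apply_first[OF assms] A.additive_pscale_right])
  show "additive (\<lambda>u. pscale sM (lmono d) (apply_first sM f ts u as))"
    by (rule additive_compose[OF M.additive_pscale_right additive_apply_first[OF assms]])
qed (simp add: A.pscale_lmono_single apply_first_single[OF assms] lmono_mult M.pscale_assoc)

lemma apply_first_dd:
  assumes "additive (\<lambda>a. f (a # as))"
    and "\<And>a. f (del sA a # as) = pscale sM (- lam 0) (f (a # as))"
  shows "apply_first sM f (t # ts) (pscale sA dd u) as =
    pscale sM (- t) (apply_first sM f (t # ts) u as)"
proof (rule additive_eqI[where v = u])
  show "additive (\<lambda>u. apply_first sM f (t # ts) (pscale sA dd u) as)"
    by (rule additive_compose[OF additive_apply_first[OF assms(1)] A.additive_pscale_right])
  show "additive (\<lambda>u. pscale sM (- t) (apply_first sM f (t # ts) u as))"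
    by (rule additive_compose[OF M.additive_pscale_right additive_apply_first[OF assms(1)]])
  fix e
  have "pscale sA dd (Poly_Mapping.single e a) = Poly_Mapping.single e (del sA a)" for a
    by (simp add: dd_def cst_def A.pscale_single del_def)
  moreover have "subst (t # ts) (- lam 0) = - t"
    by (simp add: additive.minus[OF coeffs.additive_psubst] subst_lam)
  ultimately show "apply_first sM f (t # ts) (pscale sA dd (Poly_Mapping.single e (Poly_Mapping.lookup u e))) as =
      pscale sM (- t) (apply_first sM f (t # ts) (Poly_Mapping.single e (Poly_Mapping.lookup u e)) as)"
    by (simp only: apply_first_single[OF assms(1)] assms(2) M.psubst_pscale M.pscale_assoc mult.commute)
qed

lemma apply_first_ev:
  assumes "additive (\<lambda>a. f (a # as))"
  shows "apply_first sM f ts (ev sA (lam k) P) as =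
    (\<Sum>n\<le>degree P. pscale sM (lam k ^ n) (psubst sM ts (f (coeff P n # as))))"
  unfolding ev_def
  by (simp add: additive.sum[OF additive_apply_first[OF assms]] lam_power
      apply_first_lam[OF assms] apply_first_cst[OF assms])

text \<open>
  By conformal antilinearity, d acts on the first argument as minus its variable, which here is
  \<open>lam k + t\<close>. Hence \<open>- lam k - d\<close> acts as multiplication by \<open>t\<close>.
\<close>

lemma apply_first_ev_skew:
  assumes "additive (\<lambda>a. f (a # as))"
    and "\<And>a. f (del sA a # as) = pscale sM (- lam 0) (f (a # as))"
  shows "apply_first sM f ((lam k + t) # ts) (ev sA (- lam k - dd) P) as =
    (\<Sum>n\<le>degree P. pscale sM (t ^ n) (psubst sM ((lam k + t) # ts) (f (coeff P n # as))))"
proof -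
  let ?F = "\<lambda>u. apply_first sM f ((lam k + t) # ts) u as"
  note F = additive_apply_first[OF assms(1), where ts = "(lam k + t) # ts"]
  have 1: "?F (pscale sA (- lam k - dd) u) = pscale sM t (?F u)" for u
  proof -
    have "?F (pscale sA (lam k) u) = pscale sM (lam k) (?F u)"
      unfolding lam_def by (rule apply_first_lam[OF assms(1)])
    then show ?thesis
      by (simp add: A.P.scale_left_diff_distrib A.P.scale_minus_left M.P.scale_left_distrib
          additive.diff[OF F] additive.minus[OF F] apply_first_dd[OF assms]
          M.P.scale_left_diff_distrib M.P.scale_minus_left)
  qed
  have "?F (pscale sA ((- lam k - dd) ^ n) u) = pscale sM (t ^ n) (?F u)" for n u
  proof (induction n arbitrary: u)
    case (Suc n)
    have "?F (pscale sA ((- lam k - dd) ^ Suc n) u) =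
        ?F (pscale sA (- lam k - dd) (pscale sA ((- lam k - dd) ^ n) u))"
      by (simp only: A.pscale_assoc power_Suc)
    then show ?case by (simp only: 1 Suc M.pscale_assoc power_Suc)
  qed simp
  then show ?thesis
    unfolding ev_def by (simp add: additive.sum[OF F] apply_first_cst[OF assms(1)])
qed

end

section \<open>The energy operator on polynomials\<close>

context poly_module
begin

lemma additive_energyM:
  assumes "additive (L1 act L)"
  shows "additive (energyM s act L q)"
  unfolding energyM_def[abs_def]
  by (auto simp: additive_def additive.add[OF additive_map_mpol[OF assms]]
      additive.add[OF additive_pd] P.scale_right_distrib sum.distrib)

text \<open>
  A term is an eigenvector of the Euler operator, with the total degree of its exponent vector as
  eigenvalue.
\<close>

lemma energyM_single:
  assumes "additive (L1 act L)"
  shows "energyM s act L q (Poly_Mapping.single e b) =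
    Poly_Mapping.single e (L1 act L b + s (\<Sum>i<q. of_nat (Poly_Mapping.lookup e i)) b)"
proof -
  have "pscale s (lam i) (pd s i (Poly_Mapping.single e b)) =
      Poly_Mapping.single e (s (of_nat (Poly_Mapping.lookup e i)) b)" for i
  proof (cases "Poly_Mapping.lookup e i = 0")
    case False
    then have "Poly_Mapping.single i 1 + (e - Poly_Mapping.single i 1) = e"
      by (intro poly_mapping_eqI) (auto simp: lookup_add lookup_minus lookup_single when_def)
    then show ?thesis by (simp add: pd_single lam_def pscale_lmono_single)
  qed (simp add: pd_single P.scale_zero_right)
  moreover have "Poly_Mapping.map (L1 act L) (Poly_Mapping.single e b) =
      Poly_Mapping.single e (L1 act L b)"
    using additive.zero[OF assms] additive.zero[OF additive_map_mpol[OF assms]]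
    by (cases "b = 0") simp_all
  ultimately show ?thesis
    by (simp add: energyM_def single_add scale_sum_left additive.sum[OF additive_single])
qed

lemma vars_in_energyM:
  assumes "additive (L1 act L)" "vars_in q v"
  shows "vars_in q (energyM s act L p v)"
proof -
  have "energyM s act L p v =
      (\<Sum>e\<in>Poly_Mapping.keys v. energyM s act L p (Poly_Mapping.single e (Poly_Mapping.lookup v e)))"
    by (subst mpol_sum_singles[of v]) (rule additive.sum[OF additive_energyM[OF assms(1)]])
  also have "vars_in q \<dots>"
    using assms(2) by (intro vars_in_sum) (auto simp: energyM_single[OF assms(1)] vars_in_def)
  finally show ?thesis .
qed

lemma energyM_scale:
  assumes "additive (L1 act L)" "\<And>b. L1 act L (fscale s c b) = fscale s c (L1 act L b)"
  shows "energyM s act L q (pscale s (cst [:c:]) v) = pscale s (cst [:c:]) (energyM s act L q v)"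
proof (rule additive_eqI[where v = v])
  show "additive (\<lambda>v. energyM s act L q (pscale s (cst [:c:]) v))"
    by (rule additive_compose[OF additive_energyM[OF assms(1)] additive_pscale_right])
  show "additive (\<lambda>v. pscale s (cst [:c:]) (energyM s act L q v))"
    by (rule additive_compose[OF additive_pscale_right additive_energyM[OF assms(1)]])
  fix e
  show "energyM s act L q (pscale s (cst [:c:]) (Poly_Mapping.single e (Poly_Mapping.lookup v e))) =
    pscale s (cst [:c:]) (energyM s act L q (Poly_Mapping.single e (Poly_Mapping.lookup v e)))"
    using assms(2) unfolding fscale_def
    by (simp add: cst_def pscale_single energyM_single[OF assms(1)] scale_right_distrib mult.commute)
qed

text \<open>
  Multiplication by a variable raises the degree by one.
\<close>

lemma energyM_lam:
  assumes "additive (L1 act L)" "i < q"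
  shows "energyM s act L q (pscale s (- lam i) v) =
    pscale s (- lam i) (energyM s act L q v) + pscale s (- lam i) v"
proof (rule additive_eqI[where v = v])
  show "additive (\<lambda>v. energyM s act L q (pscale s (- lam i) v))"
    by (rule additive_compose[OF additive_energyM[OF assms(1)] additive_pscale_right])
  show "additive (\<lambda>v. pscale s (- lam i) (energyM s act L q v) + pscale s (- lam i) v)"
    by (simp add: additive_def additive.add[OF additive_energyM[OF assms(1)]] P.scale_right_distrib)
  fix e
  have "(\<Sum>j<q. of_nat (Poly_Mapping.lookup (Poly_Mapping.single i 1 + e) j)) =
      1 + (\<Sum>j<q. of_nat (Poly_Mapping.lookup e j) :: 'f poly)"
  proof -
    have "of_nat (Poly_Mapping.lookup (Poly_Mapping.single i 1 + e) j) =
        (if i = j then 1 else 0) + (of_nat (Poly_Mapping.lookup e j) :: 'f poly)" for j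
      by (simp add: lookup_add lookup_single)
    then show ?thesis using assms(2) by (simp add: sum.distrib)
  qed
  then show "energyM s act L q (pscale s (- lam i) (Poly_Mapping.single e (Poly_Mapping.lookup v e))) =
    pscale s (- lam i) (energyM s act L q (Poly_Mapping.single e (Poly_Mapping.lookup v e))) +
    pscale s (- lam i) (Poly_Mapping.single e (Poly_Mapping.lookup v e))"
    by (simp add: P.scale_minus_left lam_def pscale_lmono_single additive.minus[OF additive_energyM[OF assms(1)]]
        energyM_single[OF assms(1)] scale_left_distrib single_add P.scale_right_distrib)
qed

lemma energyM_permute:
  assumes "additive (L1 act L)" "\<pi> permutes {..<q}"
  shows "energyM s act L q (psubst s (permute_list \<pi> (map lam [0..<q])) v) =
    psubst s (permute_list \<pi> (map lam [0..<q])) (energyM s act L q v)"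
proof (rule additive_eqI[where v = v])
  let ?ts = "permute_list \<pi> (map lam [0..<q]) :: 'f poly mpol list"
  show "additive (\<lambda>v. energyM s act L q (psubst s ?ts v))"
    by (rule additive_compose[OF additive_energyM[OF assms(1)] additive_psubst])
  show "additive (\<lambda>v. psubst s ?ts (energyM s act L q v))"
    by (rule additive_compose[OF additive_psubst additive_energyM[OF assms(1)]])
  fix e :: "nat \<Rightarrow>\<^sub>0 nat"
  let ?e = "\<Sum>i<q. Poly_Mapping.single (\<pi> i) (Poly_Mapping.lookup e i)"
  have "(\<Prod>i<length ?ts. ?ts ! i ^ Poly_Mapping.lookup e i) = lmono ?e"
    unfolding lam_power[symmetric] prod_lmono[symmetric]
    using permutes_lessThan[OF assms(2)] assms(2)
    by (intro prod.cong) (auto simp: permute_list_nth)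
  then have ps: "psubst s ?ts (Poly_Mapping.single e b) = Poly_Mapping.single ?e b" for b
    by (simp add: psubst_single pscale_lmono_cst)
  have "(\<Sum>j<q. Poly_Mapping.lookup ?e j) =
      (\<Sum>i<q. \<Sum>j<q. if \<pi> i = j then Poly_Mapping.lookup e i else 0)"
    by (subst sum.swap) (simp add: lookup_sum lookup_single when_def)
  also have "\<dots> = (\<Sum>i<q. Poly_Mapping.lookup e i)"
    using permutes_lessThan[OF assms(2)] by (intro sum.cong) auto
  finally have "(\<Sum>j<q. of_nat (Poly_Mapping.lookup ?e j) :: 'f poly) =
      (\<Sum>i<q. of_nat (Poly_Mapping.lookup e i))"
    by (simp flip: of_nat_sum)
  then show "energyM s act L q (psubst s ?ts (Poly_Mapping.single e (Poly_Mapping.lookup v e))) =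
    psubst s ?ts (energyM s act L q (Poly_Mapping.single e (Poly_Mapping.lookup v e)))"
    by (simp add: ps energyM_single[OF assms(1)])
qed

end

lemma free_of_of_int [simp]: "free_of j (of_int n :: 'f::field poly mpol)"
  using free_of_cst[of j "of_int n :: 'f poly"] by (simp add: cst_def)

lemma free_of_sign [simp]: "free_of j ((- 1) ^ n :: 'f::field poly mpol)"
  by (intro free_of_power free_of_minus free_of_1)

lemma permute_list_snoc:
  assumes "\<pi> permutes {..<length xs}"
  shows "permute_list \<pi> (xs @ [x]) = permute_list \<pi> xs @ [x]"
proof (rule nth_equalityI)
  have p: "\<pi> permutes {..<length (xs @ [x])}"
    by (rule permutes_subset[OF assms]) auto
  fix i assume "i < length (permute_list \<pi> (xs @ [x]))"
  then show "permute_list \<pi> (xs @ [x]) ! i = (permute_list \<pi> xs @ [x]) ! i"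
    using permutes_lessThan[OF assms, of i] permutes_not_in[OF assms, of i] assms p
    by (cases "i < length xs") (auto simp: permute_list_nth nth_append)
qed simp

lemma nths_ignore_length: "nths xs (- insert (length xs) K) = nths xs (- K)"
  unfolding nths_def by (rule arg_cong[where f = "map fst"], rule filter_cong) (auto simp: set_zip)

lemma lbilinearD:
  assumes "lbilinear sA sM br"
  shows "br 0 b = 0" "additive (br a)" "br a (fscale sM c b) = map_poly (fscale sM c) (br a b)"
proof -
  have l: "br (x + y) b = br x b + br y b"
    and r: "br a (x' + y') = br a x' + br a y'"
    and "br a (fscale sM c b) = map_poly (fscale sM c) (br a b)" for x y x' y'
    using assms unfolding lbilinear_def Vector_Spaces.linear_iff by blast+
  then show "additive (br a)" "br a (fscale sM c b) = map_poly (fscale sM c) (br a b)"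
    by (simp_all add: additive_def)
  show "br 0 b = 0"
    using l[of 0 0] by simp
qed

context cochain_modules
begin

lemma cochain_pscale:
  assumes f: "f \<in> cochains sA sM q"
  shows "(\<lambda>as. pscale sM (cst [:c:]) (f as)) \<in> cochains sA sM q"
  unfolding cochains_iff
proof (intro conjI allI impI)
  show "pscale sM (cst [:c:]) (f as) = 0" if "length as \<noteq> q" for as
    using that by (simp add: cochain_wrong_length[OF f] M.P.scale_zero_right)
  show "vars_in q (pscale sM (cst [:c:]) (f as))" for as
    by (rule vars_in_keys_subset[OF cochain_vars_in[OF f] M.keys_pscale_cst])
next
  fix as :: "'a list" and \<pi> assume "length as = q" "\<pi> permutes {..<q}"
  then show "psubst sM (permute_list \<pi> (map lam [0..<q])) (pscale sM (cst [:c:]) (f (permute_list \<pi> as))) =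
      pscale sM (of_int (sign \<pi>)) (pscale sM (cst [:c:]) (f as))"
    by (simp only: M.psubst_pscale subst_cst cochain_skew[OF f] M.pscale_assoc mult.commute)
qed (simp_all only: cochain_add[OF f]
    M.P.scale_right_distrib cochain_scale[OF f] cochain_del[OF f] M.pscale_assoc mult.commute)

text \<open>
  Multilinearity in one position after the other: the induction is on the number \<open>n\<close> of leading
  positions in which the argument is not required to lie in the spanning set.
\<close>

lemma cochains_eqI:
  assumes g: "g \<in> cochains sA sM q" and h: "h \<in> cochains sA sM q"
    and span: "module.span (fscale sA) B = UNIV"
    and eq: "\<And>as. length as = q \<Longrightarrow> set as \<subseteq> B \<Longrightarrow> g as = h as"
  shows "g = h"
proof
  interpret V: vector_space "fscale sA" by (rule A.vector_space_fscale)
  have main: "g as = h as"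
    if "n \<le> q" "length as = q" "\<forall>i. n \<le> i \<longrightarrow> i < q \<longrightarrow> as ! i \<in> B" for n as
    using that
  proof (induction n arbitrary: as)
    case 0
    then show ?case by (intro eq) (auto simp: set_conv_nth)
  next
    case (Suc n)
    then have n: "length as = q" "n < q" by simp_all
    have sub: "V.subspace {a. g (as[n := a]) = h (as[n := a])}"
    proof (rule V.subspaceI)
      show "0 \<in> {a. g (as[n := a]) = h (as[n := a])}"
        using cochain_add[OF g n, of 0 0] cochain_add[OF h n, of 0 0] by simp
    qed (simp_all add: cochain_add[OF g n] cochain_add[OF h n] cochain_scale[OF g n]
        cochain_scale[OF h n])
    have "g (as[n := a]) = h (as[n := a])" if "a \<in> B" for a
    proof (rule Suc.IH)
      show "\<forall>i. n \<le> i \<longrightarrow> i < q \<longrightarrow> as[n := a] ! i \<in> B"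
        using Suc.prems that by (auto simp: nth_list_update)
    qed (use n in simp_all)
    then have "V.span B \<subseteq> {a. g (as[n := a]) = h (as[n := a])}"
      using V.span_minimal[OF _ sub] by blast
    then have "as ! n \<in> {a. g (as[n := a]) = h (as[n := a])}"
      unfolding span by (rule subsetD) (rule UNIV_I)
    then show ?case by simp
  qed
  fix as
  show "g as = h as"
    using main[of q as] cochain_wrong_length[OF g, of as] cochain_wrong_length[OF h, of as]
    by (cases "length as = q") auto
qed

end

section \<open>The energy operator on cochains\<close>

locale virasoro_setting = cochain_modules sA sM
  for sA :: "'f::field_char_0 poly \<Rightarrow> 'a::ab_group_add \<Rightarrow> 'a"
    and sM :: "'f poly \<Rightarrow> 'm::ab_group_add \<Rightarrow> 'm" +
  fixes br :: "'a \<Rightarrow> 'a \<Rightarrow> 'a poly" and act :: "'a \<Rightarrow> 'm \<Rightarrow> 'm poly" and L :: 'a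
  assumes lca_mod: "lca_module sA br sM act"
    and virasoro: "virasoro_element sA br L"
begin

lemma lca: "lie_conformal_algebra sA br"
  using lca_mod by (simp add: lca_module_def)

lemmas br_lin = lbilinearD[OF lie_conformal_algebra.br_bilinear[OF lca]]
lemmas act_lin = lbilinearD[OF lca_module.act_bilinear[OF lca_mod]]

text \<open>
  Substituting \<open>t\<close> in the skew-symmetry axiom. In the differential the bracket is evaluated at the
  variable of its left argument, which may be any of the variables.
\<close>

lemma br_skew_ev: "ev sA t (br a b) = - ev sA (- t - dd) (br b a)"
proof -
  have "psubst sA [t] (ev sA (lam 0) (br a b)) = psubst sA [t] (- ev sA (- lam 0 - dd) (br b a))"
    by (simp only: lie_conformal_algebra.br_skew[OF lca, of a b])
  moreover have "subst [t] (lam 0) = t" "subst [t] (- lam 0 - dd) = - t - dd"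
    by (simp_all add: additive.diff[OF coeffs.additive_psubst]
        additive.minus[OF coeffs.additive_psubst] subst_lam dd_def subst_cst)
  ultimately show ?thesis
    by (simp add: additive.minus[OF A.additive_psubst] A.psubst_ev)
qed

lemma L0_eq: "coeff (br L a) 0 = del sA a"
  using virasoro unfolding virasoro_element_def L0_def fun_eq_iff by simp

lemma L1_add: "L1 br L (a + b) = L1 br L a + L1 br L b"
  by (simp add: L1_def additive.add[OF br_lin(2)])

lemma L1_scale: "L1 br L (fscale sA c a) = fscale sA c (L1 br L a)"
  by (simp add: L1_def br_lin(3) coeff_map_poly A.fscale_0)

text \<open>
  The linear coefficient of sesquilinearity in the second argument; the extra term is the action
  of \<open>L0\<close>, which is d. So d raises the weight of an eigenvector by one.
\<close>

lemma L1_del: "L1 br L (del sA a) = del sA (L1 br L a) + del sA a"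
proof -
  have "lcoeff 0 1 (ev sA (lam 0) (br L (del sA a))) =
      lcoeff 0 1 (pscale sA (dd + lam 0) (ev sA (lam 0) (br L a)))"
    by (simp only: lie_conformal_algebra.br_del_right[OF lca])
  moreover have "lcoeff 0 0 (dd + lam 0 :: 'f poly mpol) = dd" "lcoeff 0 (Suc 0) (dd + lam 0 :: 'f poly mpol) = 1"
    using free_of_dd[of 0, where ?'a = 'f] lcoeff_lam_power[of 0 0 1, where ?'f = 'f]
      lcoeff_lam_power[of 0 1 1, where ?'f = 'f]
    by (simp_all add: lcoeff_add free_of_def)
  moreover note A.lcoeff_ev_lam[of 0 0] A.lcoeff_ev_lam[of 1 0]
  ultimately have "cst (L1 br L (del sA a)) = (cst (del sA (L1 br L a) + del sA a) :: 'a mpol)"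
    by (simp add: A.lcoeff_1_pscale L1_def L0_eq dd_def A.pscale_cst add.commute cst_add flip: del_def)
  then show ?thesis by simp
qed

lemma L1_act_add: "additive (L1 act L)"
  by (rule M.additive_L1[OF act_lin(2)])

lemma L1_act_scale: "L1 act L (fscale sM c m) = fscale sM c (L1 act L m)"
  by (simp add: L1_def act_lin(3) coeff_map_poly M.fscale_0)

text \<open>
  The eigenvalues of the arguments appear in the energy operator only through the sum of all
  ways to apply \<open>L1\<close> to one argument. Writing this sum instead gives a formula that makes sense
  for arguments that are not eigenvectors.
\<close>

definition explicit_energy :: "nat \<Rightarrow> ('a list \<Rightarrow> 'm mpol) \<Rightarrow> 'a list \<Rightarrow> 'm mpol" where
  "explicit_energy q f as = (if length as = q then
     energyM sM act L q (f as) + pscale sM (cst [:of_nat q:]) (f as) -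
       (\<Sum>j<q. f (as[j := L1 br L (as ! j)])) else 0)"

text \<open>
  For antilinearity in the \<open>i\<close>-th argument, applying d there produces one extra term through the
  Euler operator, which counts the new factor \<open>- lam i\<close>, and one through \<open>L1_del\<close>; the two cancel.
  Skew-symmetry holds because the operators and the sum over the arguments treat all positions
  alike.
\<close>

lemma explicit_energy_cochain:
  assumes f: "f \<in> cochains sA sM q"
  shows "explicit_energy q f \<in> cochains sA sM q"
  unfolding cochains_iff
proof (intro conjI allI impI)
  let ?E = "energyM sM act L q"
  note E_add = additive.add[OF M.additive_energyM[OF L1_act_add]]
  show "explicit_energy q f as = 0" if "length as \<noteq> q" for as
    using that by (simp add: explicit_energy_def)
  show "vars_in q (explicit_energy q f as)" for as
  proof (cases "length as = q")
    case True
    show ?thesis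
      unfolding explicit_energy_def if_P[OF True]
      by (intro vars_in_diff vars_in_add vars_in_sum M.vars_in_energyM[OF L1_act_add]
          cochain_vars_in[OF f] vars_in_keys_subset[OF cochain_vars_in[OF f] M.keys_pscale_cst])
  qed (simp add: explicit_energy_def)
  {
    fix as :: "'a list" and i assume i: "length as = q" "i < q"
    \<comment> \<open>Changing the i-th argument changes the summands j other than i only in position i.\<close>
    have upd: "f (as[i := a, j := L1 br L (as[i := a] ! j)]) =
        (if j = i then f (as[i := L1 br L a]) else f (as[j := L1 br L (as ! j), i := a]))" for a j
      using i by (auto simp: list_update_swap)
    note i' = i(2) and l = length_list_update[of as, unfolded i(1)]
    show "explicit_energy q f (as[i := a + b]) =
        explicit_energy q f (as[i := a]) + explicit_energy q f (as[i := b])" for a b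
    proof -
      have "f (as[i := a + b, j := L1 br L (as[i := a + b] ! j)]) =
          f (as[i := a, j := L1 br L (as[i := a] ! j)]) +
          f (as[i := b, j := L1 br L (as[i := b] ! j)])" for j
        unfolding upd by (simp add: L1_add cochain_add[OF f _ i'] i)
      then show ?thesis
        by (simp add: explicit_energy_def i cochain_add[OF f _ i'] E_add M.P.scale_right_distrib
            sum.distrib)
    qed
    show "explicit_energy q f (as[i := fscale sA c a]) =
        pscale sM (cst [:c:]) (explicit_energy q f (as[i := a]))" for c a
    proof -
      have "f (as[i := fscale sA c a, j := L1 br L (as[i := fscale sA c a] ! j)]) =
          pscale sM (cst [:c:]) (f (as[i := a, j := L1 br L (as[i := a] ! j)]))" for j
        unfolding upd by (simp add: L1_scale cochain_scale[OF f _ i'] i)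
      then show ?thesis
        by (simp add: explicit_energy_def i cochain_scale[OF f _ i']
            M.energyM_scale[OF L1_act_add L1_act_scale] M.P.scale_right_distrib
            M.P.scale_right_diff_distrib M.P.scale_sum_right
            mult.commute)
    qed
    show "explicit_energy q f (as[i := del sA (as ! i)]) = pscale sM (- lam i) (explicit_energy q f as)"
    proof -
      let ?W = "\<lambda>as j. f (as[j := L1 br L (as ! j)])"
      have "?W (as[i := del sA (as ! i)]) j =
          pscale sM (- lam i) (?W as j) + (if j = i then pscale sM (- lam i) (f as) else 0)"
        for j
      proof (cases "j = i")
        case True
        then show ?thesis
          unfolding upd using i
          by (simp only: L1_del cochain_add[OF f _ i'] cochain_del'[OF f _ i'] list_update_id if_True simp_thms)
      next
        case False
        have "f (as[j := L1 br L (as ! j), i := del sA (as ! i)]) = pscale sM (- lam i) (?W as j)"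
          using cochain_del[OF f, of "as[j := L1 br L (as ! j)]" i] i False by simp
        then show ?thesis unfolding upd using False by simp
      qed
      then have "(\<Sum>j<q. ?W (as[i := del sA (as ! i)]) j) =
          pscale sM (- lam i) (\<Sum>j<q. ?W as j) + pscale sM (- lam i) (f as)"
        using i by (simp add: sum.distrib sum_subtractf sum_negf M.P.scale_sum_right)
      moreover have "?E (f (as[i := del sA (as ! i)])) =
          pscale sM (- lam i) (?E (f as)) + pscale sM (- lam i) (f as)"
        using i by (simp only: cochain_del[OF f] M.energyM_lam[OF L1_act_add])
      ultimately show ?thesis
        unfolding explicit_energy_def using i
        by (simp only: cochain_del[OF f] length_list_update if_True M.P.scale_right_distrib
            M.P.scale_right_diff_distrib M.pscale_left_commute[of "cst [:of_nat q:]"])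
          (simp add: M.P.scale_right_distrib M.P.scale_right_diff_distrib mult.commute)
    qed
  }
  fix as :: "'a list" and \<pi> assume l: "length as = q" and p: "\<pi> permutes {..<q}"
  let ?ts = "permute_list \<pi> (map lam [0..<q]) :: 'f poly mpol list"
  let ?s = "of_int (sign \<pi>) :: 'f poly mpol"
  have s_cst: "?s = cst [:of_int (sign \<pi>):]"
    by (simp add: cst_def of_int_poly flip: single_of_int)
  have pl: "(permute_list \<pi> as)[j := L1 br L (permute_list \<pi> as ! j)] =
      permute_list \<pi> (as[\<pi> j := L1 br L (as ! \<pi> j)])" if "j < q" for j
  proof (rule nth_equalityI)
    fix i assume "i < length ((permute_list \<pi> as)[j := L1 br L (permute_list \<pi> as ! j)])"
    then have "i < q" using l by simp
    then show "(permute_list \<pi> as)[j := L1 br L (permute_list \<pi> as ! j)] ! i =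
        permute_list \<pi> (as[\<pi> j := L1 br L (as ! \<pi> j)]) ! i"
      using l p that permutes_lessThan[OF p] permutes_inj[OF p]
      by (simp add: permute_list_nth nth_list_update inj_eq)
  qed simp
  have "psubst sM ?ts (\<Sum>j<q. f ((permute_list \<pi> as)[j := L1 br L (permute_list \<pi> as ! j)])) =
      (\<Sum>j<q. pscale sM ?s (f (as[\<pi> j := L1 br L (as ! \<pi> j)])))"
    unfolding additive.sum[OF M.additive_psubst]
    using l p by (intro sum.cong) (simp_all add: pl cochain_skew[OF f])
  also have "\<dots> = pscale sM ?s (\<Sum>j<q. f (as[j := L1 br L (as ! j)]))"
    using sum.permute[OF p, of "\<lambda>j. pscale sM ?s (f (as[j := L1 br L (as ! j)]))"]
    by (simp add: o_def M.P.scale_sum_right)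
  finally have S: "psubst sM ?ts (\<Sum>j<q. f ((permute_list \<pi> as)[j := L1 br L (permute_list \<pi> as ! j)])) =
      pscale sM ?s (\<Sum>j<q. f (as[j := L1 br L (as ! j)]))" .
  have "psubst sM ?ts (?E (f (permute_list \<pi> as))) = pscale sM ?s (?E (f as))"
    unfolding M.energyM_permute[OF L1_act_add p, symmetric] cochain_skew[OF f l p]
    unfolding s_cst by (rule M.energyM_scale[OF L1_act_add L1_act_scale])
  then show "psubst sM ?ts (explicit_energy q f (permute_list \<pi> as)) = pscale sM ?s (explicit_energy q f as)"
    using l
    by (simp add: explicit_energy_def additive.add[OF M.additive_psubst]
        additive.diff[OF M.additive_psubst] S M.psubst_pscale subst_cst cochain_skew[OF f l p]
        M.P.scale_right_distrib M.P.scale_right_diff_distrib mult.commute)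
qed

text \<open>
  There is a basis of eigenvectors of \<open>L1\<close>, so a cochain is determined by its values on them. The
  explicit formula is therefore the cochain that the definition of the energy operator describes.
\<close>

lemma energy_eq_explicit:
  assumes f: "f \<in> cochains sA sM q"
  shows "energy sA br sM act L q f = explicit_energy q f"
  unfolding energy_def
proof (rule the_equality)
  let ?R = "\<lambda>as ds. energyM sM act L q (f as) + pscale sM (cst [:of_nat q - sum_list ds:]) (f as)"
  have on_eigenvectors: "explicit_energy q f as = ?R as ds"
    if as: "length as = q" "list_all2 (eigenvector sA (L1 br L)) ds as" for as ds
  proof -
    have ds: "length ds = q" using list_all2_lengthD[OF as(2)] as(1) by simp
    have "f (as[j := L1 br L (as ! j)]) = pscale sM (cst [:ds ! j:]) (f as)" if "j < q" for j
    proof -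
      have "L1 br L (as ! j) = fscale sA (ds ! j) (as ! j)"
        using list_all2_nthD[OF as(2), of j] that ds by (simp add: eigenvector_def)
      then show ?thesis using cochain_scale[OF f as(1) that, of "ds ! j" "as ! j"] by simp
    qed
    then have "(\<Sum>j<q. f (as[j := L1 br L (as ! j)])) =
        pscale sM (\<Sum>j<q. cst [:ds ! j:]) (f as)"
      by (simp add: M.P.scale_sum_left)
    also have "(\<Sum>j<q. cst [:ds ! j:] :: 'f poly mpol) = cst [:sum_list ds:]"
    proof -
      have "additive (\<lambda>x. cst [:x:] :: 'f poly mpol)"
        by (simp add: additive_def flip: cst_add)
      from additive.sum[OF this, of "(!) ds" "{..<q}"] show ?thesis
        by (simp add: sum_list_sum_nth ds atLeast0LessThan)
    qed
    moreover have "cst [:of_nat q - sum_list ds:] = (cst [:of_nat q:] - cst [:sum_list ds:] :: 'f poly mpol)"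
      by (simp flip: cst_diff)
    ultimately show ?thesis
      using as(1) by (simp add: explicit_energy_def M.P.scale_left_diff_distrib)
  qed
  show "explicit_energy q f \<in> cochains sA sM q \<and>
    (\<forall>as ds. length as = q \<and> list_all2 (eigenvector sA (L1 br L)) ds as \<longrightarrow>
      explicit_energy q f as = ?R as ds)"
    using explicit_energy_cochain[OF f] on_eigenvectors by blast
  fix g
  assume g: "g \<in> cochains sA sM q \<and>
    (\<forall>as ds. length as = q \<and> list_all2 (eigenvector sA (L1 br L)) ds as \<longrightarrow> g as = ?R as ds)"
  obtain B where B: "module.span (fscale sA) B = UNIV" "\<forall>b\<in>B. \<exists>c. eigenvector sA (L1 br L) c b"
    using virasoro unfolding virasoro_element_def diagonalizable_def is_basis_def by blast
  show "g = explicit_energy q f"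
  proof (rule cochains_eqI[OF _ explicit_energy_cochain[OF f] B(1)])
    fix as :: "'a list" assume as: "length as = q" "set as \<subseteq> B"
    from B(2) obtain d where d: "\<And>b. b \<in> B \<Longrightarrow> eigenvector sA (L1 br L) (d b) b" by metis
    have "list_all2 (eigenvector sA (L1 br L)) (map d as) as"
      using as(2) d by (auto simp: list_all2_conv_all_nth set_conv_nth)
    then show "g as = explicit_energy q f as"
      using g on_eigenvectors as(1) by metis
  qed (use g in blast)
qed

section \<open>Contraction with the Virasoro element\<close>

text \<open>
  The derivative at 0 of the insertion of L. Inserting L in the last position keeps the numbering
  of the remaining variables; it differs from inserting it in the first position by a sign.
\<close>

definition contraction :: "('a list \<Rightarrow> 'm mpol) \<Rightarrow> 'a list \<Rightarrow> 'm mpol" where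
  "contraction f as = lcoeff (length as) 1 (f (as @ [L]))"

lemma contraction_cochain:
  assumes f: "f \<in> cochains sA sM (Suc p)"
  shows "contraction f \<in> cochains sA sM p"
  unfolding cochains_iff
proof (intro conjI allI impI)
  show "contraction f as = 0" if "length as \<noteq> p" for as
    using that by (simp add: contraction_def cochain_wrong_length[OF f])
  show "vars_in p (contraction f as)" for as
  proof (cases "length as = p")
    case True
    then show ?thesis
      unfolding contraction_def using vars_in_lcoeff[OF cochain_vars_in[OF f]] by simp
  qed (simp add: contraction_def cochain_wrong_length[OF f])
next
  fix as :: "'a list" and i assume i: "length as = p" "i < p"
  have upd: "as[i := a] @ [L] = (as @ [L])[i := a]" for a
    using i by (simp add: list_update_append)
  have l: "length (as @ [L]) = Suc p" "i < Suc p" using i by simp_all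
  show "contraction f (as[i := a + b]) = contraction f (as[i := a]) + contraction f (as[i := b])" for a b
    by (simp add: contraction_def upd cochain_add[OF f l] lcoeff_add)
  show "contraction f (as[i := fscale sA c a]) = pscale sM (cst [:c:]) (contraction f (as[i := a]))" for c a
    unfolding contraction_def upd cochain_scale[OF f l]
    by (simp only: M.lcoeff_pscale_free[OF free_of_cst] length_list_update)
  show "contraction f (as[i := del sA (as ! i)]) = pscale sM (- lam i) (contraction f as)"
  proof -
    have "free_of (length as) (- lam i :: 'f poly mpol)"
      using i by (intro free_of_minus free_of_lam) auto
    moreover have "f (as[i := del sA (as ! i)] @ [L]) = pscale sM (- lam i) (f (as @ [L]))"
      using cochain_del[OF f l] i by (simp add: upd nth_append)
    ultimately show ?thesis
      unfolding contraction_def by (simp only: M.lcoeff_pscale_free length_list_update)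
  qed
next
  fix as :: "'a list" and \<pi> assume l: "length as = p" and p: "\<pi> permutes {..<p}"
  have p': "\<pi> permutes {..<Suc p}" by (rule permutes_subset[OF p]) auto
  let ?us = "permute_list \<pi> (map lam [0..<p]) :: 'f poly mpol list"
  have "psubst sM (?us @ [lam p]) (f (permute_list \<pi> as @ [L])) = pscale sM (of_int (sign \<pi>)) (f (as @ [L]))"
    using cochain_skew[OF f _ p', of "as @ [L]"] l p by (simp add: permute_list_snoc)
  moreover have "free_of p u" if "u \<in> set ?us" for u
    using that p by (auto intro!: free_of_lam)
  ultimately show "psubst sM ?us (contraction f (permute_list \<pi> as)) =
      pscale sM (of_int (sign \<pi>)) (contraction f as)"
    using M.lcoeff_psubst_last[of ?us p "f (permute_list \<pi> as @ [L])"] l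
    by (simp add: contraction_def M.lcoeff_pscale_free[simplified])
qed

text \<open>
  The contribution of the bracket of one argument with the inserted L. Skew-symmetry turns it into
  the bracket \<open>[L a]\<close> at the variable \<open>lam q\<close> of L, whose coefficients of degree 0 and 1 are \<open>L0 a = d a\<close>
  and \<open>L1 a\<close>; higher coefficients cannot contribute to the linear coefficient in \<open>lam q\<close>. The
  first one gives \<open>- (lam k + lam q)\<close> times a shifted value of \<open>f\<close>, and the linear part of that
  consists of an Euler term and \<open>f\<close> itself.
\<close>

lemma lcoeff_bracket_term:
  assumes f: "f \<in> cochains sA sM q" and l: "length as = q" and k: "k < q"
  shows "lcoeff q 1 (apply_first sM f ((lam k + lam q) # nths (map lam [0..<q]) (- {k}))
      (ev sA (lam k) (br (as ! k) L)) (nths as (- {k}))) =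
    pscale sM ((-1) ^ k) (pscale sM (lam k) (pd sM k (f as)) + f as - f (as[k := L1 br L (as ! k)]))"
proof -
  let ?a = "as ! k" and ?as = "nths as (- {k})"
  let ?ts = "(lam k + lam q) # nths (map lam [0..<q]) (- {k}) :: 'f poly mpol list"
  let ?us = "(map lam [0..<q])[k := lam k + lam q] :: 'f poly mpol list"
  let ?P = "br L ?a"
  let ?X = "\<lambda>n. psubst sM ?ts (f (coeff ?P n # ?as))"
  note add = cochain_additive_first[OF f, of ?as]
  have l': "length (x # ?as) = q" for x
    using l k by (simp add: nths_Compl_singleton)
  have del: "f (del sA x # ?as) = pscale sM (- lam 0) (f (x # ?as))" for x
    using cochain_del[OF f l', of 0 x] k by simp
  have move: "psubst sM ?ts (f (x # ?as)) = pscale sM ((-1) ^ k) (psubst sM ?us (f (as[k := x])))" for x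
    by (rule cochain_first_to_nth[OF f l _ k]) simp
  have "lcoeff q 1 (apply_first sM f ?ts (ev sA (lam k) (br ?a L)) ?as) =
      - lcoeff q 1 (\<Sum>n\<le>degree ?P. pscale sM (lam q ^ n) (?X n))"
    unfolding br_skew_ev[of "lam k" ?a L] additive.minus[OF additive_apply_first[OF add]]
      apply_first_ev_skew[OF add del] lcoeff_minus ..
  \<comment> \<open>The bracket may be constant in its variable; one more summand makes the index 1 available.\<close>
  also have "(\<Sum>n\<le>degree ?P. pscale sM (lam q ^ n) (?X n)) =
      (\<Sum>n\<le>Suc (degree ?P). pscale sM (lam q ^ n) (?X n))"
    by (simp add: coeff_eq_0 additive.zero[OF add] additive.zero[OF M.additive_psubst]
        M.P.scale_zero_right)
  also have "lcoeff q 1 \<dots> = (\<Sum>n\<le>Suc (degree ?P). (if n = 0 then lcoeff q 1 (?X 0) else 0) +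
      (if n = 1 then lcoeff q 0 (?X 1) else 0))"
    unfolding lcoeff_sum
    by (intro sum.cong) (auto simp: M.lcoeff_1_pscale lcoeff_lam_power lcoeff_of_1 M.P.scale_zero_left
        lcoeff_lam_power[of _ _ 1, simplified])
  also have "\<dots> = lcoeff q 1 (?X 0) + lcoeff q 0 (?X 1)"
    by (simp only: sum.distrib sum.delta finite_atMost) simp
  also have "lcoeff q 0 (?X 1) = pscale sM ((-1) ^ k) (f (as[k := L1 br L ?a]))"
    using M.lcoeff_psubst_shift(1)[OF cochain_vars_in[OF f] k] free_of_sign[of q k, where ?'f = 'f]
    by (simp add: move M.lcoeff_0_pscale free_of_def L1_def)
  also have "lcoeff q 1 (?X 0) = - pscale sM ((-1) ^ k) (pscale sM (lam k) (pd sM k (f as)) + f as)"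
  proof -
    let ?v = "psubst sM ?us (f as)"
    have "subst ?us (- lam k) = - (lam k + lam q)"
      using k by (simp add: additive.minus[OF coeffs.additive_psubst] subst_lam)
    then have "?X 0 = - pscale sM ((-1) ^ k) (pscale sM (lam k + lam q) ?v)"
      unfolding L0_eq move cochain_del[OF f l k] M.psubst_pscale
      by (simp only: M.P.scale_minus_left M.P.scale_minus_right)
    then have "lcoeff q 1 (?X 0) = - pscale sM ((-1) ^ k) (lcoeff q 1 (pscale sM (lam k + lam q) ?v))"
      by (simp only: lcoeff_minus M.lcoeff_pscale_free free_of_sign)
    moreover have "lcoeff q 0 (lam k + lam q :: 'f poly mpol) = lam k"
      "lcoeff q 1 (lam k + lam q :: 'f poly mpol) = 1"
      using lcoeff_shifted_power[OF free_of_lam[of k q, where ?'a = 'f], of 1] k by simp_all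
    ultimately show ?thesis
      using M.lcoeff_psubst_shift[OF cochain_vars_in[OF f, of as] k]
      by (simp add: M.lcoeff_1_pscale add.commute)
  qed
  finally show ?thesis
    by (simp add: M.P.scale_right_diff_distrib)
qed

text \<open>
  Cartan's formula for the derivative at 0 of the insertion of L. In the differential evaluated
  with L as an additional last argument, the terms in which L is left alone form the differential
  of the contraction. The term in which L acts on M, and those with a bracket of an argument with
  L, assemble to the energy operator: the action gives \<open>L1\<close> on M, and each argument contributes
  its Euler term, a summand \<open>f\<close>, and \<open>- f\<close> with \<open>L1\<close> applied to that argument.
\<close>

lemma homotopy_formula:
  assumes f: "f \<in> cochains sA sM q" and l: "length as = q"
  shows "lcoeff q 1 (differential sA br sM act f (as @ [L])) =
    differential sA br sM act (contraction f) as + pscale sM ((-1) ^ q) (explicit_energy q f as)"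
proof -
  let ?ls = "map lam [0..<q] :: 'f poly mpol list"
  have ls: "map lam [0..<Suc q] = ?ls @ [lam q]" by simp
  have fr: "free_of q u" if "u \<in> set (nths ?ls I)" for u I
    using in_set_nthsD[OF that] by (auto intro: free_of_lam)
  have len: "length (nths ?ls I) = length (nths as I)" for I
    using l by (simp add: length_nths)
  have flam: "free_of q (lam k :: 'f poly mpol)" if "k < q" for k
    using that by (intro free_of_lam) auto
  let ?S = "\<lambda>k. lprod sM act (lam k) (cst ((as @ [L]) ! k))
    (psubst sM (nths (?ls @ [lam q]) (- {k})) (f (nths (as @ [L]) (- {k}))))"
  let ?D = "\<lambda>l k. apply_first sM f ((lam k + lam l) # nths (?ls @ [lam q]) (- {k, l}))
    (ev sA (lam k) (br ((as @ [L]) ! k) ((as @ [L]) ! l))) (nths (as @ [L]) (- {k, l}))"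
  have S: "lcoeff q 1 (?S k) = lprod sM act (lam k) (cst (as ! k))
      (psubst sM (nths ?ls (- {k})) (contraction f (nths as (- {k}))))" if "k < q" for k
  proof -
    have "nths (?ls @ [lam q]) (- {k}) = nths ?ls (- {k}) @ [lam q]"
      "nths (as @ [L]) (- {k}) = nths as (- {k}) @ [L]"
      using that l by (simp_all add: nths_append)
    then show ?thesis
      using that l M.lcoeff_lprod[where br = act, OF act_lin(1,2) flam[OF that]]
        M.lcoeff_psubst_last[OF fr[where I = "- {k}"]]
      by (simp add: nth_append contraction_def len)
  qed
  have Sq: "lcoeff q 1 (?S q) = Poly_Mapping.map (L1 act L) (f as)"
  proof -
    have "nths (?ls @ [lam q]) (- {q}) = ?ls" "nths (as @ [L]) (- {q}) = as" "(as @ [L]) ! q = L"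
      using l by (simp_all add: nths_append nths_all nth_append)
    then show ?thesis
      using l M.lcoeff_lprod_lam[where br = act, OF act_lin(1,2) cochain_vars_in[OF f]]
      by (simp add: M.psubst_ident[OF cochain_vars_in[OF f]])
  qed
  have D: "lcoeff q 1 (?D l k) = apply_first sM (contraction f) ((lam k + lam l) # nths ?ls (- {k, l}))
      (ev sA (lam k) (br (as ! k) (as ! l))) (nths as (- {k, l}))" if "k < l" "l < q" for k l
  proof -
    have eq: "nths (?ls @ [lam q]) (- {k, l}) = nths ?ls (- {k, l}) @ [lam q]"
      "nths (as @ [L]) (- {k, l}) = nths as (- {k, l}) @ [L]"
      using that \<open>length as = q\<close> by (simp_all add: nths_append)
    let ?us = "(lam k + lam l) # nths ?ls (- {k, l}) :: 'f poly mpol list"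
    let ?as = "nths as (- {k, l})"
    note add = cochain_additive_first[OF f, of "?as @ [L]"]
    have add': "additive (\<lambda>a. contraction f (a # ?as))"
      using additive_compose[OF additive_lcoeff add] by (simp add: contraction_def)
    have "free_of q u" if "u \<in> set ?us" for u
      using that fr \<open>k < l\<close> \<open>l < q\<close> by (auto intro!: free_of_add flam)
    then have "lcoeff q 1 (psubst sM (?us @ [lam q]) (f (x # ?as @ [L]))) =
        psubst sM ?us (contraction f (x # ?as))" for x
      using M.lcoeff_psubst_last[of ?us q "f (x # ?as @ [L])"] by (simp add: contraction_def len)
    then have "lcoeff q 1 (pscale sM (lam k ^ n) (psubst sM (?us @ [lam q]) (f (x # ?as @ [L])))) =
        pscale sM (lam k ^ n) (psubst sM ?us (contraction f (x # ?as)))" for n x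
      using M.lcoeff_pscale_free[OF free_of_power[OF flam[of k]]] that by simp
    then show ?thesis
      using that \<open>length as = q\<close>
      by (simp add: eq nth_append apply_first_ev[OF add] apply_first_ev[OF add'] lcoeff_sum)
  qed
  have Dq: "lcoeff q 1 (?D q k) = pscale sM ((-1) ^ k)
      (pscale sM (lam k) (pd sM k (f as)) + f as - f (as[k := L1 br L (as ! k)]))" if "k < q" for k
  proof -
    have "nths (?ls @ [lam q]) (- {k, q}) = nths ?ls (- {k})"
      "nths (as @ [L]) (- {k, q}) = nths as (- {k})"
      using that l nths_ignore_length[of ?ls "{k}"] nths_ignore_length[of as "{k}"]
      by (simp_all add: nths_append insert_commute)
    then show ?thesis
      using lcoeff_bracket_term[OF f l that] that l by (simp add: nth_append)
  qed
  \<comment> \<open>The sign of the bracket term against the sign of moving the bracket to the k-th position.\<close>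
  have sgn: "pscale sM ((-1) ^ (k + q)) (pscale sM ((-1) ^ k) v) = pscale sM ((-1) ^ q) v" for k v
    by (simp add: M.pscale_assoc power_add mult.commute flip: power_mult_distrib mult.assoc)
  have "lcoeff q 1 (differential sA br sM act f (as @ [L])) =
      (\<Sum>k<Suc q. pscale sM ((-1) ^ k) (lcoeff q 1 (?S k))) +
      (\<Sum>l<Suc q. \<Sum>k<l. pscale sM ((-1) ^ (k + l)) (lcoeff q 1 (?D l k)))"
    unfolding differential_def Let_def
    by (simp only: length_append_singleton l ls lcoeff_add lcoeff_sum M.lcoeff_pscale_free free_of_sign)
  also have "\<dots> = differential sA br sM act (contraction f) as +
      (pscale sM ((-1) ^ q) (Poly_Mapping.map (L1 act L) (f as)) +
       (\<Sum>k<q. pscale sM ((-1) ^ q) (pscale sM (lam k) (pd sM k (f as)) + f as - f (as[k := L1 br L (as ! k)]))))"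
  proof -
    have "(\<Sum>k<q. pscale sM ((-1) ^ k) (lcoeff q 1 (?S k))) =
        (\<Sum>k<q. pscale sM ((-1) ^ k) (lprod sM act (lam k) (cst (as ! k))
          (psubst sM (nths ?ls (- {k})) (contraction f (nths as (- {k}))))))"
      by (intro sum.cong refl) (simp only: S lessThan_iff)
    moreover have "(\<Sum>l<q. \<Sum>k<l. pscale sM ((-1) ^ (k + l)) (lcoeff q 1 (?D l k))) =
        (\<Sum>l<q. \<Sum>k<l. pscale sM ((-1) ^ (k + l)) (apply_first sM (contraction f)
          ((lam k + lam l) # nths ?ls (- {k, l}))
          (ev sA (lam k) (br (as ! k) (as ! l))) (nths as (- {k, l}))))"
      by (intro sum.cong refl) (simp only: D lessThan_iff)
    moreover have "(\<Sum>k<q. pscale sM ((-1) ^ (k + q)) (lcoeff q 1 (?D q k))) =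
        (\<Sum>k<q. pscale sM ((-1) ^ q)
          (pscale sM (lam k) (pd sM k (f as)) + f as - f (as[k := L1 br L (as ! k)])))"
      by (intro sum.cong refl) (simp only: Dq sgn lessThan_iff)
    ultimately show ?thesis
      unfolding differential_def Let_def sum.lessThan_Suc l Sq by (simp only: ac_simps)
  qed
  also have "\<dots> = differential sA br sM act (contraction f) as +
      pscale sM ((-1) ^ q) (explicit_energy q f as)"
  proof -
    have "cst [:of_nat q:] = (of_nat q :: 'f poly mpol)"
      by (simp add: cst_def flip: of_nat_poly)
    then have "pscale sM (cst [:of_nat q:]) (f as) = (\<Sum>k<q. f as)"
      using M.P.sum_constant_scale[of "f as" "{..<q}"] by simp
    then show ?thesis
      using l by (simp add: explicit_energy_def energyM_def sum.distrib sum_subtractf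
          M.P.scale_right_distrib M.P.scale_right_diff_distrib M.P.scale_sum_right)
  qed
  finally show ?thesis .
qed

lemma differential_pscale:
  "differential sA br sM act (\<lambda>as. pscale sM (cst [:c:]) (g as)) as =
    pscale sM (cst [:c:]) (differential sA br sM act g as)"
  unfolding differential_def Let_def apply_first_def
  by (simp only: M.psubst_pscale subst_cst M.lprod_scale[where br = act, OF act_lin] M.P.scale_sum_right
      M.P.scale_right_distrib M.pscale_left_commute[of _ "cst [:c:]"])

lemma differential_wrong_length:
  assumes "g \<in> cochains sA sM p" "length as \<noteq> Suc p"
  shows "differential sA br sM act g as = 0"
proof -
  have "g (nths as (- {k})) = 0" if "k < length as" for k
    using that assms by (intro cochain_wrong_length) (auto simp: nths_Compl_singleton)
  moreover have "g (x # nths as (- {k, l})) = 0" if "k < l" "l < length as" for x k l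
  proof (rule cochain_wrong_length[OF assms(1)])
    have "length (nths as (- {k, l})) = card ({..<length as} - {k, l})"
      unfolding length_nths by (rule arg_cong[where f = card]) auto
    also have "\<dots> = length as - 2" using that by (simp add: card_Diff_subset)
    finally show "length (x # nths as (- {k, l})) \<noteq> p" using assms(2) that by simp
  qed
  ultimately show ?thesis
    by (simp add: differential_def Let_def apply_first_def additive.zero[OF M.additive_psubst]
        additive.zero[OF M.additive_lprod_cst[where br = act, OF act_lin(1,2)]] M.P.scale_zero_right)
qed

text \<open>
  On a cocycle the left-hand side of the homotopy formula vanishes, so the weight times \<open>f\<close> is,
  up to sign, the differential of the contraction, and a nonzero weight can be divided out.
\<close>

theorem cocycle_nonzero_weight_coboundary:
  assumes f: "f \<in> cochains sA sM q" and w: "conformal_weight sA br sM act L q f \<Delta>"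
    and "cocycle sA br sM act f" and "\<Delta> \<noteq> 0"
  shows "coboundary sA br sM act q f"
proof -
  \<comment> \<open>The inverse of the factor by which the homotopy formula multiplies f; the sign is its own inverse.\<close>
  define c where "c = - ((-1) ^ q / \<Delta>)"
  have "[:- 1:] = - (1 :: 'f poly)" by (simp add: one_pCons)
  then have s: "(-1) ^ q = (cst [:(-1) ^ q:] :: 'f poly mpol)"
    by (cases "even q") (simp_all add: cst_minus flip: one_pCons)
  have eq: "f as = pscale sM (cst [:c:]) (differential sA br sM act (contraction f) as)"
    if "length as = q" for as
  proof -
    let ?d = "differential sA br sM act (contraction f) as"
    have "explicit_energy q f as = pscale sM (cst [:\<Delta>:]) (f as)"
      using w energy_eq_explicit[OF f] unfolding conformal_weight_def by metis
    then have "?d = pscale sM (- (cst [:(-1) ^ q:] * cst [:\<Delta>:])) (f as)"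
      using homotopy_formula[OF f that] assms(3)
      by (simp add: cocycle_def s M.pscale_assoc M.P.scale_minus_left eq_neg_iff_add_eq_0)
    then have "pscale sM (cst [:c:]) ?d = pscale sM (cst [:c * (- ((-1) ^ q * \<Delta>)):]) (f as)"
      by (simp add: M.pscale_assoc mult.commute flip: cst_mult cst_minus)
    also have "c * (- ((-1) ^ q * \<Delta>)) = 1"
      using \<open>\<Delta> \<noteq> 0\<close> by (simp add: c_def flip: power_mult_distrib)
    finally show ?thesis by (simp flip: one_pCons)
  qed
  show ?thesis
  proof (cases q)
    case 0
    have "f as = 0" for as
      using eq[of as] cochain_wrong_length[OF f, of as] 0
      by (cases "as = []") (simp_all add: differential_def M.P.scale_zero_right)
    then show ?thesis using 0 by (auto simp: coboundary_def)
  next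
    case (Suc p)
    let ?g = "\<lambda>as. pscale sM (cst [:c:]) (contraction f as)"
    have g: "?g \<in> cochains sA sM p"
      by (rule cochain_pscale[OF contraction_cochain[OF f[unfolded Suc]]])
    moreover have "f as = differential sA br sM act ?g as" for as
      using eq[of as] cochain_wrong_length[OF f, of as] differential_wrong_length[OF g, of as] Suc
      by (cases "length as = q") (simp_all add: differential_pscale)
    ultimately show ?thesis using Suc by (auto simp: coboundary_def)
  qed
qed

end

theorem theorem3p7:
  fixes sA :: "'f::field_char_0 poly \<Rightarrow> 'a::ab_group_add \<Rightarrow> 'a"
    and br :: "'a \<Rightarrow> 'a \<Rightarrow> 'a poly"
    and sM :: "'f poly \<Rightarrow> 'm::ab_group_add \<Rightarrow> 'm"
    and act :: "'a \<Rightarrow> 'm \<Rightarrow> 'm poly"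
    and L :: 'a
    and q :: nat
    and f :: "'a list \<Rightarrow> 'm mpol"
    and \<Delta> :: 'f
  assumes "lie_conformal_algebra sA br"
    and "virasoro_element sA br L"
    and "free_on_eigenvectors sA (L1 br L)"
    and "lca_module sA br sM act"
    and "conformal_module sM act L"
    and "free_on_eigenvectors sM (L1 act L)"
    and "f \<in> cochains sA sM q"
    and "conformal_weight sA br sM act L q f \<Delta>"
    and "cocycle sA br sM act f"
    and "\<not> coboundary sA br sM act q f"
  shows "\<Delta> = 0"
proof (rule ccontr)
  interpret lca_module sA br sM act by (rule assms(4))
  interpret virasoro_setting sA sM br act L
    using assms(2,4) module_axioms M.module_axioms
    by (simp add: virasoro_setting_def virasoro_setting_axioms_def cochain_modules_def poly_module_def)
  assume "\<Delta> \<noteq> 0"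
  from cocycle_nonzero_weight_coboundary[OF assms(7-9) this] assms(10) show False by contradiction
qed

end
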